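(* Let $m\in\mathbb Z$ and $q\in\mathcal K$. Let $\overline{\mathcal{HV}}{}^\circ=\mathcal A^\circ\oplus\mathcal A^\circ$ and let $\Delta$ be the cobracket on it determined by $$\Delta\big((\varepsilon^p,0)\big)=\sum_{i+j=p+1}(j-i)(\varepsilon^i,0)\otimes(\varepsilon^j,0),\qquad \Delta\big((0,\varepsilon^p)\big)=\sum_{i+j=p+1}\big(j(\varepsilon^i,0)\otimes(0,\varepsilon^j)-i(0,\varepsilon^i)\otimes(\varepsilon^j,0)\big)\quad(p\in\mathbb Z).$$ (1) Let $(\overline{\mathcal{HV}},\varphi,\Delta_r)$ be the coboundary triangular Lie bialgebra related to the solution of CYBE $r=(x,0)\otimes(x,qx^m)-(x,qx^m)\otimes(x,0)$. Then its dual Lie bialgebra is $(\overline{\mathcal{HV}}{}^{\circ},[\cdot,\cdot],\Delta)$, where the bracket is uniquely determined by (for $i,j\in\mathbb Z$): (a) $[(\varepsilon^i,0),(\varepsilon^j,0)]=0$; (b) $[(\varepsilon^i,0),(0,\varepsilon^j)]=\begin{cases}mq(\varepsilon^{j-m+1},0)&\text{if } i=1,\\ (1-i)q(\varepsilon^i,0)&\text{if } i\neq1,\ j=m,\\ 0&\text{if } i\neq1,\ j\neq m;\end{cases}$ (c) $[(0,\varepsilon^i),(0,\varepsilon^j)]=\begin{cases}jq(0,\varepsilon^j)&\text{if } i=m,\ j\neq m,\\ 0&\text{if } i\neq m,\ j\neq m.\end{cases}$ (2) Let $(\overline{\mathcal{HV}},\varphi,\Delta_{r'})$ be the coboundary triangular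 Lie bialgebra related to the solution of CYBE $r'=(x,0)\otimes(0,qx^m)-(0,qx^m)\otimes(x,0)$. Then its dual Lie bialgebra is $(\overline{\mathcal{HV}}{}^{\circ},[\cdot,\cdot],\Delta)$, where the bracket is uniquely determined by (for $i,j\in\mathbb Z$): (a) $[(\varepsilon^i,0),(\varepsilon^j,0)]=0$; (b) $[(\varepsilon^i,0),(0,\varepsilon^j)]=\begin{cases}mq(\varepsilon^{j-m+1},0)&\text{if } i=1,\\ (1-i)q(\varepsilon^i,0)&\text{if } i\neq1,\ j=m,\\ 0&\text{if } i\neq1,\ j\neq m;\end{cases}$ (c) $[(0,\varepsilon^i),(0,\varepsilon^j)]=\begin{cases}jq(0,\varepsilon^j)&\text{if } i=m,\ j\neq m,\\ 0&\text{if } i\neq m,\ j\neq m.\end{cases}$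
   Context: $\mathcal K$ is an algebraically closed field of characteristic zero, $\mathcal A=\mathcal K[x^{\pm1}]$, $\partial=\frac{d}{dx}$. $\overline{\mathcal{HV}}=\mathcal A\oplus\mathcal A$ is the centerless twisted Heisenberg-Virasoro algebra with Lie bracket $\varphi=[\cdot,\cdot]$, $[(f_1,f_2),(g_1,g_2)]=(f_1\partial g_1-g_1\partial f_1,\ f_1\partial g_2-g_1\partial f_2)$; with $L_m=(x^{m+1},0)$, $I_n=(0,x^n)$ this reads $[L_m,L_n]=(n-m)L_{m+n}$, $[I_m,I_n]=0$, $[L_m,I_n]=nI_{m+n}$. Lie bialgebra: a Lie algebra with a Lie cobracket $\delta$ such that $\delta[x,y]=x\cdot\delta(y)-y\cdot\delta(x)$, where $x\cdot(y\otimes z)=[x,y]\otimes z+y\otimes[x,z]$. For $r\in\overline{\mathcal{HV}}\otimes\overline{\mathcal{HV}}$, $\Delta_r(z)=z\cdot r$; the bialgebra is coboundary triangular if its cobracket is $\Delta_r$ with $r$ satisfying the classical Yang-Baxter equation (CYBE) $[r_{12},r_{13}]+[r_{12},r_{23}]+[r_{13},r_{23}]=0$. $\varphi^*:\overline{\mathcal{HV}}{}^*\to(\overline{\mathcal{HV}}\otimes\overline{\mathcal{HV}})^*$ is the dual of the bracket; $\overline{\mathcal{HV}}{}^{\circ}$ is the maximal good subspace of $\overline{\mathcal{HV}}{}^*$, i.e. the sum of all subspaces $U$ with $\varphi^*(U)\subset U\otimes U$. It equals $\mathcal A^\circ\oplus\mathcal A^\circ$ with $\mathcal A^\circ=\{\sum_{i\in\mathbb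 Z}f_i\varepsilon^i\in\mathcal A^*\mid \exists\, r\in\mathbb N,\ c_1,\dots,c_r\in\mathcal K:\ f_n=\sum_{j=1}^r c_jf_{n-j}\ \forall n\in\mathbb Z\}$. The dual Lie bialgebra of a Lie bialgebra $(\overline{\mathcal{HV}},\varphi,\delta)$ is $\overline{\mathcal{HV}}{}^\circ$ with bracket and cobracket dual to $\delta$ and $\varphi$: $\langle[f,h],\xi\rangle=\langle f\otimes h,\delta(\xi)\rangle$ and $\langle\Delta f,\xi\otimes\eta\rangle=\langle f,[\xi,\eta]\rangle$ for $f,h\in\overline{\mathcal{HV}}{}^\circ$, $\xi,\eta\in\overline{\mathcal{HV}}$. $\varepsilon^i\in\mathcal A^*$ is given by $\varepsilon^i(x^j)=\delta_{i,j}$; every $f\in\mathcal A^*$ is written as a formal (possibly infinite) sum $\sum_j f_j\varepsilon^j$, $f_j=f(x^j)$. $(\varepsilon^i,0)(x^k,x^l)=\delta_{i,k}$, $(0,\varepsilon^i)(x^k,x^l)=\delta_{i,l}$. Infinite sums denote functionals evaluated termwise; the formulas on the $\varepsilon^i$ are formulas for the dual maps $\varphi^*$ and $(f,h)\mapsto(f\otimes h)\circ\delta$ on these functionals, and the structure on $\overline{\mathcal{HV}}{}^\circ$ is obtained by extending them to formal infinite linear combinations (remaining brackets following from skew-symmetry). *)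

theory Defs
  imports
    "HOL-Library.Poly_Mapping"
    "HOL-Library.Function_Algebras"
    "HOL-Computational_Algebra.Polynomial"
begin

section \<open>Vector spaces with a distinguished basis, and functions into the field\<close>

text \<open>
  \<open>'b \<Rightarrow>\<^sub>0 'k\<close> is the vector space with basis \<open>'b\<close>. Functionals on it are total functions
  \<open>('b \<Rightarrow>\<^sub>0 'k) \<Rightarrow> 'k\<close> with pointwise operations; the full dual space is the set \<open>dual\<close> below.
\<close>

definition vscale :: "'k::field \<Rightarrow> ('b \<Rightarrow>\<^sub>0 'k) \<Rightarrow> ('b \<Rightarrow>\<^sub>0 'k)" where
  "vscale c = Poly_Mapping.map ((*) c)"

definition fscale :: "'k::field \<Rightarrow> ('x \<Rightarrow> 'k) \<Rightarrow> ('x \<Rightarrow> 'k)" where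
  "fscale c f = (\<lambda>x. c * f x)"

lemma lookup_vscale [simp]:
  "Poly_Mapping.lookup (vscale c v) b = c * Poly_Mapping.lookup v b"
  by (simp add: vscale_def Poly_Mapping.map.rep_eq when_def)

global_interpretation vs: vector_space "vscale :: 'k::field \<Rightarrow> ('b \<Rightarrow>\<^sub>0 'k) \<Rightarrow> _"
  by unfold_locales (auto intro!: poly_mapping_eqI simp: lookup_add algebra_simps)

global_interpretation fs: vector_space "fscale :: 'k::field \<Rightarrow> ('x \<Rightarrow> 'k) \<Rightarrow> _"
  by unfold_locales (auto simp: fscale_def fun_eq_iff algebra_simps)

definition basis :: "'b \<Rightarrow> ('b \<Rightarrow>\<^sub>0 'k::field)" where
  "basis b = Poly_Mapping.single b 1"

definition dual :: "(('b \<Rightarrow>\<^sub>0 'k::field) \<Rightarrow> 'k) set" where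
  "dual = {f. Vector_Spaces.linear vscale (*) f}"

definition dual_basis :: "'b \<Rightarrow> ('b \<Rightarrow>\<^sub>0 'k::field) \<Rightarrow> 'k" where
  "dual_basis b v = Poly_Mapping.lookup v b"

definition bilinear_maps ::
  "('k::field \<Rightarrow> 'w::ab_group_add \<Rightarrow> 'w) \<Rightarrow> (('b \<Rightarrow>\<^sub>0 'k) \<Rightarrow> ('c \<Rightarrow>\<^sub>0 'k) \<Rightarrow> 'w) set" where
  "bilinear_maps s = {\<beta>. (\<forall>u. Vector_Spaces.linear vscale s (\<beta> u)) \<and>
                         (\<forall>v. Vector_Spaces.linear vscale s (\<lambda>u. \<beta> u v))}"

section \<open>Tensor products\<close>

text \<open>
  The tensor product of the spaces with bases \<open>'b\<close> and \<open>'c\<close> is the space with basis \<open>'b \<times> 'c\<close>;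
  \<open>tensor_universal\<close> is its universal property. Triple tensor products are \<open>V \<otimes> (V \<otimes> V)\<close>.
\<close>

lift_definition tensor ::
  "('b \<Rightarrow>\<^sub>0 'k::field) \<Rightarrow> ('c \<Rightarrow>\<^sub>0 'k) \<Rightarrow> ('b \<times> 'c \<Rightarrow>\<^sub>0 'k)" (infixr "\<otimes>\<^sub>t" 72)
  is "\<lambda>u v (b, c). u b * v c"
proof -
  fix u :: "'b \<Rightarrow> 'k" and v :: "'c \<Rightarrow> 'k"
  assume "finite {b. u b \<noteq> 0}" "finite {c. v c \<noteq> 0}"
  then have "finite ({b. u b \<noteq> 0} \<times> {c. v c \<noteq> 0})" by simp
  then show "finite {p. (case p of (b, c) \<Rightarrow> u b * v c) \<noteq> 0}"
    by (rule rev_finite_subset) auto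
qed

text \<open>\<open>tlift s \<beta>\<close> is the linear map on the tensor product, with values in a space with scalar
  multiplication \<open>s\<close>, that sends \<open>u \<otimes> v\<close> to \<open>\<beta> u v\<close>; it is only used for bilinear \<open>\<beta>\<close>.\<close>

definition tlift ::
  "('k::field \<Rightarrow> 'w::ab_group_add \<Rightarrow> 'w) \<Rightarrow> (('b \<Rightarrow>\<^sub>0 'k) \<Rightarrow> ('c \<Rightarrow>\<^sub>0 'k) \<Rightarrow> 'w) \<Rightarrow>
   ('b \<times> 'c \<Rightarrow>\<^sub>0 'k) \<Rightarrow> 'w" where
  "tlift s \<beta> t =
     (\<Sum>(b, c) \<in> Poly_Mapping.keys t. s (Poly_Mapping.lookup t (b, c)) (\<beta> (basis b) (basis c)))"

lemma poly_mapping_expand: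
  fixes v :: "'b \<Rightarrow>\<^sub>0 'k::field"
  shows "v = (\<Sum>b\<in>Poly_Mapping.keys v. vscale (Poly_Mapping.lookup v b) (basis b))"
proof (rule poly_mapping_eqI)
  fix a
  have "Poly_Mapping.lookup (\<Sum>b\<in>Poly_Mapping.keys v. vscale (Poly_Mapping.lookup v b) (basis b)) a
      = (\<Sum>b\<in>Poly_Mapping.keys v. if b = a then Poly_Mapping.lookup v b else 0)"
    unfolding lookup_sum by (rule sum.cong) (auto simp: basis_def lookup_single when_def)
  also have "\<dots> = Poly_Mapping.lookup v a"
    by (simp add: sum.delta in_keys_iff)
  finally show "Poly_Mapping.lookup v a =
      Poly_Mapping.lookup (\<Sum>b\<in>Poly_Mapping.keys v. vscale (Poly_Mapping.lookup v b) (basis b)) a"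
    by simp
qed

lemma linear_expand:
  assumes "Vector_Spaces.linear vscale s f"
  shows "f v = (\<Sum>b\<in>Poly_Mapping.keys v. s (Poly_Mapping.lookup v b) (f (basis b)))"
proof -
  interpret Vector_Spaces.linear vscale s f by fact
  show ?thesis
    by (subst poly_mapping_expand[of v]) (simp add: sum scale)
qed

lemma basis_tensor_basis: "basis b \<otimes>\<^sub>t basis c = basis (b, c)"
  by (rule poly_mapping_eqI)
     (auto simp: tensor.rep_eq basis_def lookup_single when_def split: prod.splits)

lemma tlift_over:
  assumes "vector_space s" "finite A" "Poly_Mapping.keys t \<subseteq> A"
  shows "tlift s \<beta> t = (\<Sum>(b, c)\<in>A. s (Poly_Mapping.lookup t (b, c)) (\<beta> (basis b) (basis c)))"
proof -
  interpret vector_space s by fact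
  show ?thesis
    unfolding tlift_def using assms(2,3)
    by (intro sum.mono_neutral_left) (auto simp: in_keys_iff)
qed

lemma linear_tlift:
  assumes "vector_space s"
  shows "Vector_Spaces.linear vscale s (tlift s \<beta>)"
proof -
  interpret vector_space s by fact
  have add: "tlift s \<beta> (t + u) = tlift s \<beta> t + tlift s \<beta> u" for t u
  proof -
    let ?A = "Poly_Mapping.keys t \<union> Poly_Mapping.keys u"
    have "Poly_Mapping.keys (t + u) \<subseteq> ?A" by (rule Poly_Mapping.keys_add)
    then show ?thesis
      by (simp add: tlift_over[OF assms, of ?A] lookup_add scale_left_distrib
          sum.distrib case_prod_unfold)
  qed
  have scale: "tlift s \<beta> (vscale c t) = s c (tlift s \<beta> t)" for c t
  proof -
    have "Poly_Mapping.keys (vscale c t) \<subseteq> Poly_Mapping.keys t" by (auto simp: in_keys_iff)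
    then show ?thesis
      by (simp add: tlift_over[OF assms, of "Poly_Mapping.keys t"] scale_sum_right
          case_prod_unfold)
  qed
  show ?thesis
    using add scale assms vs.vector_space_axioms by (simp add: Vector_Spaces.linear_iff)
qed

lemma tensor_bilinear: "(\<otimes>\<^sub>t) \<in> bilinear_maps vscale"
  unfolding bilinear_maps_def Vector_Spaces.linear_iff
  by (auto simp: vs.vector_space_axioms tensor.rep_eq lookup_add algebra_simps
      intro!: poly_mapping_eqI)

lemma tlift_tensor:
  assumes "vector_space s" "\<beta> \<in> bilinear_maps s"
  shows "tlift s \<beta> (u \<otimes>\<^sub>t v) = \<beta> u v"
proof -
  interpret vector_space s by fact
  have l1: "Vector_Spaces.linear vscale s (\<beta> u)"
    and l2: "\<And>v. Vector_Spaces.linear vscale s (\<lambda>u. \<beta> u v)"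
    using assms(2) by (auto simp: bilinear_maps_def)
  let ?A = "Poly_Mapping.keys u" and ?B = "Poly_Mapping.keys v"
  have "Poly_Mapping.keys (u \<otimes>\<^sub>t v) \<subseteq> ?A \<times> ?B"
    by (auto simp: in_keys_iff tensor.rep_eq)
  then have "tlift s \<beta> (u \<otimes>\<^sub>t v) =
      (\<Sum>(b, c)\<in>?A \<times> ?B. s (Poly_Mapping.lookup (u \<otimes>\<^sub>t v) (b, c)) (\<beta> (basis b) (basis c)))"
    by (intro tlift_over) (auto intro: assms)
  also have "\<dots> = (\<Sum>b\<in>?A. \<Sum>c\<in>?B. s (Poly_Mapping.lookup v c)
      (s (Poly_Mapping.lookup u b) (\<beta> (basis b) (basis c))))"
    by (simp add: sum.cartesian_product tensor.rep_eq mult.commute case_prod_unfold)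
  also have "\<dots> = (\<Sum>c\<in>?B. s (Poly_Mapping.lookup v c) (\<beta> u (basis c)))"
    by (subst sum.swap) (simp add: linear_expand[OF l2, of u] scale_sum_right)
  also have "\<dots> = \<beta> u v"
    by (simp add: linear_expand[OF l1, of v])
  finally show ?thesis .
qed

lemma tensor_universal:
  assumes "vector_space s" "\<beta> \<in> bilinear_maps s"
  shows "\<exists>!F. Vector_Spaces.linear vscale s F \<and> (\<forall>u v. F (u \<otimes>\<^sub>t v) = \<beta> u v)"
proof (rule ex1I)
  show "Vector_Spaces.linear vscale s (tlift s \<beta>) \<and> (\<forall>u v. tlift s \<beta> (u \<otimes>\<^sub>t v) = \<beta> u v)"
    by (simp add: linear_tlift tlift_tensor assms)
next
  fix F assume F: "Vector_Spaces.linear vscale s F \<and> (\<forall>u v. F (u \<otimes>\<^sub>t v) = \<beta> u v)"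
  then have \<beta>: "\<beta> u v = F (u \<otimes>\<^sub>t v)" for u v by simp
  show "F = tlift s \<beta>"
  proof
    fix t
    show "F t = tlift s \<beta> t"
      using F linear_expand[of s F t]
      by (simp add: tlift_def case_prod_unfold \<beta> basis_tensor_basis)
  qed
qed

definition twist :: "('b \<times> 'b \<Rightarrow>\<^sub>0 'k::field) \<Rightarrow> ('b \<times> 'b \<Rightarrow>\<^sub>0 'k)" where
  "twist = tlift vscale (\<lambda>x y. y \<otimes>\<^sub>t x)"

text \<open>\<open>x \<otimes> y \<otimes> z \<mapsto> y \<otimes> z \<otimes> x\<close>\<close>

definition cyc :: "('b \<times> 'b \<times> 'b \<Rightarrow>\<^sub>0 'k::field) \<Rightarrow> ('b \<times> 'b \<times> 'b \<Rightarrow>\<^sub>0 'k)" where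
  "cyc = tlift vscale (\<lambda>x. tlift vscale (\<lambda>y z. y \<otimes>\<^sub>t z \<otimes>\<^sub>t x))"

text \<open>The functional \<open>f \<otimes> h\<close> on \<open>V \<otimes> W\<close>, and \<open>U \<otimes> U\<close> as a subspace of \<open>(V \<otimes> V)\<^sup>*\<close>.\<close>

definition ftensor ::
  "(('b \<Rightarrow>\<^sub>0 'k::field) \<Rightarrow> 'k) \<Rightarrow> (('c \<Rightarrow>\<^sub>0 'k) \<Rightarrow> 'k) \<Rightarrow> ('b \<times> 'c \<Rightarrow>\<^sub>0 'k) \<Rightarrow> 'k"
  (infixr "\<otimes>\<^sub>f" 72) where
  "f \<otimes>\<^sub>f h = tlift (*) (\<lambda>u v. f u * h v)"

definition fun_tensor_square ::
  "(('b \<Rightarrow>\<^sub>0 'k::field) \<Rightarrow> 'k) set \<Rightarrow> (('b \<times> 'b \<Rightarrow>\<^sub>0 'k) \<Rightarrow> 'k) set" where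
  "fun_tensor_square U = fs.span {f \<otimes>\<^sub>f h | f h. f \<in> U \<and> h \<in> U}"

section \<open>Lie bialgebras\<close>

type_synonym ('b, 'k) bracket = "('b \<Rightarrow>\<^sub>0 'k) \<Rightarrow> ('b \<Rightarrow>\<^sub>0 'k) \<Rightarrow> ('b \<Rightarrow>\<^sub>0 'k)"
type_synonym ('b, 'k) cobracket = "('b \<Rightarrow>\<^sub>0 'k) \<Rightarrow> ('b \<times> 'b \<Rightarrow>\<^sub>0 'k)"
type_synonym ('b, 'k) functional = "('b \<Rightarrow>\<^sub>0 'k) \<Rightarrow> 'k"

definition lie_algebra :: "('b, 'k::field) bracket \<Rightarrow> bool" where
  "lie_algebra \<phi> \<longleftrightarrow>
     \<phi> \<in> bilinear_maps vscale \<and>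
     (\<forall>x. \<phi> x x = 0) \<and>
     (\<forall>x y z. \<phi> x (\<phi> y z) + \<phi> y (\<phi> z x) + \<phi> z (\<phi> x y) = 0)"

definition lie_coalgebra :: "('b, 'k::field) cobracket \<Rightarrow> bool" where
  "lie_coalgebra \<delta> \<longleftrightarrow>
     Vector_Spaces.linear vscale vscale \<delta> \<and>
     (\<forall>x. \<exists>t. \<delta> x = t - twist t) \<and>
     (\<forall>x. let t = tlift vscale (\<lambda>y z. y \<otimes>\<^sub>t \<delta> z) (\<delta> x) in t + cyc t + cyc (cyc t) = 0)"

definition act ::
  "('b, 'k::field) bracket \<Rightarrow> ('b \<Rightarrow>\<^sub>0 'k) \<Rightarrow> ('b \<times> 'b \<Rightarrow>\<^sub>0 'k) \<Rightarrow> ('b \<times> 'b \<Rightarrow>\<^sub>0 'k)" where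
  "act \<phi> x = tlift vscale (\<lambda>y z. \<phi> x y \<otimes>\<^sub>t z + y \<otimes>\<^sub>t \<phi> x z)"

definition lie_bialgebra :: "('b, 'k::field) bracket \<Rightarrow> ('b, 'k) cobracket \<Rightarrow> bool" where
  "lie_bialgebra \<phi> \<delta> \<longleftrightarrow>
     lie_algebra \<phi> \<and> lie_coalgebra \<delta> \<and>
     (\<forall>x y. \<delta> (\<phi> x y) = act \<phi> x (\<delta> y) - act \<phi> y (\<delta> x))"

definition coboundary :: "('b, 'k::field) bracket \<Rightarrow> ('b \<times> 'b \<Rightarrow>\<^sub>0 'k) \<Rightarrow> ('b, 'k) cobracket" where
  "coboundary \<phi> r z = act \<phi> z r"

text \<open>The three summands are \<open>[r\<^sub>1\<^sub>2, r\<^sub>1\<^sub>3]\<close>, \<open>[r\<^sub>1\<^sub>2, r\<^sub>2\<^sub>3]\<close> and \<open>[r\<^sub>1\<^sub>3, r\<^sub>2\<^sub>3]\<close>, written for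
  \<open>r = \<Sum> a \<otimes> b\<close> (first copy) and \<open>r = \<Sum> c \<otimes> d\<close> (second copy).\<close>

definition CYBE :: "('b, 'k::field) bracket \<Rightarrow> ('b \<times> 'b \<Rightarrow>\<^sub>0 'k) \<Rightarrow> bool" where
  "CYBE \<phi> r \<longleftrightarrow>
     tlift vscale (\<lambda>a b. tlift vscale (\<lambda>c d. \<phi> a c \<otimes>\<^sub>t b \<otimes>\<^sub>t d) r) r +
     tlift vscale (\<lambda>a b. tlift vscale (\<lambda>c d. a \<otimes>\<^sub>t \<phi> b c \<otimes>\<^sub>t d) r) r +
     tlift vscale (\<lambda>a b. tlift vscale (\<lambda>c d. a \<otimes>\<^sub>t c \<otimes>\<^sub>t \<phi> b d) r) r = 0"

definition coboundary_triangular ::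
  "('b, 'k::field) bracket \<Rightarrow> ('b, 'k) cobracket \<Rightarrow> ('b \<times> 'b \<Rightarrow>\<^sub>0 'k) \<Rightarrow> bool" where
  "coboundary_triangular \<phi> \<delta> r \<longleftrightarrow> lie_bialgebra \<phi> \<delta> \<and> \<delta> = coboundary \<phi> r \<and> CYBE \<phi> r"

section \<open>The dual Lie bialgebra\<close>

definition dual_map ::
  "('b, 'k::field) bracket \<Rightarrow> ('b, 'k) functional \<Rightarrow> ('b \<times> 'b, 'k) functional" where
  "dual_map \<phi> f = f \<circ> tlift vscale \<phi>"

definition dual_bracket ::
  "('b, 'k::field) cobracket \<Rightarrow> ('b, 'k) functional \<Rightarrow> ('b, 'k) functional \<Rightarrow>
   ('b, 'k) functional" where
  "dual_bracket \<delta> f h = (f \<otimes>\<^sub>f h) \<circ> \<delta>"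

definition good_subspace :: "('b, 'k::field) bracket \<Rightarrow> ('b, 'k) functional set \<Rightarrow> bool" where
  "good_subspace \<phi> U \<longleftrightarrow>
     fs.subspace U \<and> U \<subseteq> dual \<and> dual_map \<phi> ` U \<subseteq> fun_tensor_square U"

definition max_good :: "('b, 'k::field) bracket \<Rightarrow> ('b, 'k) functional set" where
  "max_good \<phi> = fs.span (\<Union> {U. good_subspace \<phi> U})"

text \<open>
  Lie bialgebra axioms on a subspace \<open>C\<close> of the dual space, for operations defined on (at least)
  \<open>C\<close>, with \<open>C \<otimes> C\<close> inside \<open>(V \<otimes> V)\<^sup>*\<close> and \<open>C \<otimes> C \<otimes> C\<close> inside \<open>(V \<otimes> V \<otimes> V)\<^sup>*\<close>. An element of
  \<open>C \<otimes> C\<close> is given by a list of pairs from \<open>C\<close>; the axioms that involve \<open>1 \<otimes> \<Delta>\<close> or the action on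
  \<open>C \<otimes> C\<close> are required for every such list representing the cobrackets in question.
\<close>

definition represents ::
  "('b, 'k::field) functional set \<Rightarrow> (('b, 'k) functional \<times> ('b, 'k) functional) list \<Rightarrow>
   ('b \<times> 'b, 'k) functional \<Rightarrow> bool" where
  "represents C ps t \<longleftrightarrow> set ps \<subseteq> C \<times> C \<and> t = (\<Sum>(y, z)\<leftarrow>ps. y \<otimes>\<^sub>f z)"

definition fact_on ::
  "(('b, 'k::field) functional \<Rightarrow> ('b, 'k) functional \<Rightarrow> ('b, 'k) functional) \<Rightarrow>
   ('b, 'k) functional \<Rightarrow> (('b, 'k) functional \<times> ('b, 'k) functional) list \<Rightarrow>
   ('b \<times> 'b, 'k) functional" where
  "fact_on br f ps = (\<Sum>(y, z)\<leftarrow>ps. br f y \<otimes>\<^sub>f z + y \<otimes>\<^sub>f br f z)"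

definition lie_bialgebra_on ::
  "('b, 'k::field) functional set \<Rightarrow>
   (('b, 'k) functional \<Rightarrow> ('b, 'k) functional \<Rightarrow> ('b, 'k) functional) \<Rightarrow>
   (('b, 'k) functional \<Rightarrow> ('b \<times> 'b, 'k) functional) \<Rightarrow> bool" where
  "lie_bialgebra_on C br \<Delta> \<longleftrightarrow>
     fs.subspace C \<and> C \<subseteq> dual \<and>
     (\<forall>f\<in>C. \<forall>g\<in>C. br f g \<in> C) \<and>
     (\<forall>f\<in>C. \<forall>g\<in>C. \<forall>h\<in>C. \<forall>c. br (fscale c f + g) h = fscale c (br f h) + br g h \<and>
                               br h (fscale c f + g) = fscale c (br h f) + br h g) \<and>
     (\<forall>f\<in>C. br f f = 0) \<and>
     (\<forall>f\<in>C. \<forall>g\<in>C. \<forall>h\<in>C. br f (br g h) + br g (br h f) + br h (br f g) = 0) \<and>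
     (\<forall>f\<in>C. \<Delta> f \<in> fun_tensor_square C) \<and>
     (\<forall>f\<in>C. \<forall>g\<in>C. \<forall>c. \<Delta> (fscale c f + g) = fscale c (\<Delta> f) + \<Delta> g) \<and>
     (\<forall>f\<in>C. \<exists>t\<in>fun_tensor_square C. \<Delta> f = t - (t \<circ> twist)) \<and>
     (\<forall>f\<in>C. \<forall>ps. represents C ps (\<Delta> f) \<longrightarrow>
        (let t = (\<Sum>(y, z)\<leftarrow>ps. y \<otimes>\<^sub>f \<Delta> z) in t + (t \<circ> cyc) + (t \<circ> cyc \<circ> cyc) = 0)) \<and>
     (\<forall>f\<in>C. \<forall>h\<in>C. \<forall>ps qs. represents C ps (\<Delta> f) \<and> represents C qs (\<Delta> h) \<longrightarrow>
        \<Delta> (br f h) = fact_on br f qs - fact_on br h ps)"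

definition dual_lie_bialgebra ::
  "('b, 'k::field) bracket \<Rightarrow> ('b, 'k) cobracket \<Rightarrow>
   ('b, 'k) functional set \<Rightarrow>
   (('b, 'k) functional \<Rightarrow> ('b, 'k) functional \<Rightarrow> ('b, 'k) functional) \<Rightarrow>
   (('b, 'k) functional \<Rightarrow> ('b \<times> 'b, 'k) functional) \<Rightarrow> bool" where
  "dual_lie_bialgebra \<phi> \<delta> C br \<Delta> \<longleftrightarrow>
     C = max_good \<phi> \<and> lie_bialgebra_on C br \<Delta> \<and>
     (\<forall>f\<in>C. \<forall>h\<in>C. \<forall>\<xi>. br f h \<xi> = (f \<otimes>\<^sub>f h) (\<delta> \<xi>)) \<and>
     (\<forall>f\<in>C. \<forall>\<xi> \<eta>. \<Delta> f (\<xi> \<otimes>\<^sub>t \<eta>) = f (\<phi> \<xi> \<eta>))"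

section \<open>Formal infinite sums of functionals\<close>

text \<open>\<open>formal_sum g I F\<close>: the possibly infinite sum \<open>\<Sum>i\<in>I. g i\<close>, evaluated termwise, makes sense
  and equals \<open>F\<close>.\<close>

definition formal_sum :: "('i \<Rightarrow> 'x \<Rightarrow> 'k::field) \<Rightarrow> 'i set \<Rightarrow> ('x \<Rightarrow> 'k) \<Rightarrow> bool" where
  "formal_sum g I F \<longleftrightarrow>
     (\<forall>x. finite {i\<in>I. g i x \<noteq> 0} \<and> F x = (\<Sum>i | i \<in> I \<and> g i x \<noteq> 0. g i x))"

text \<open>Extension from the dual basis to formal infinite linear combinations
  \<open>f = \<Sum>b. f (basis b) \<cdot> dual_basis b\<close>, in one and in two arguments.\<close>

definition formally_linear ::
  "(('b, 'k::field) functional \<Rightarrow> ('x \<Rightarrow> 'k)) \<Rightarrow> bool" where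
  "formally_linear F \<longleftrightarrow>
     (\<forall>f\<in>dual. formal_sum (\<lambda>b. fscale (f (basis b)) (F (dual_basis b))) UNIV (F f))"

definition formally_bilinear ::
  "(('b, 'k::field) functional \<Rightarrow> ('b, 'k) functional \<Rightarrow> ('x \<Rightarrow> 'k)) \<Rightarrow> bool" where
  "formally_bilinear B \<longleftrightarrow>
     (\<forall>f\<in>dual. \<forall>h\<in>dual.
        formal_sum (\<lambda>(b, c). fscale (f (basis b) * h (basis c)) (B (dual_basis b) (dual_basis c)))
          UNIV (B f h))"

section \<open>The centerless twisted Heisenberg-Virasoro algebra\<close>

text \<open>
  Laurent polynomials form the group ring of \<open>\<int>\<close>, so that multiplication is the library's
  convolution product. The direct sum \<open>\<A> \<oplus> \<A>\<close> has basis \<open>int + int\<close>: \<open>Inl i\<close> stands for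
  \<open>(x\<^sup>i, 0)\<close> and \<open>Inr i\<close> for \<open>(0, x\<^sup>i)\<close>; \<open>hv f g\<close> is the element \<open>(f, g)\<close>.
\<close>

type_synonym 'k laurent = "int \<Rightarrow>\<^sub>0 'k"
type_synonym 'k hv = "int + int \<Rightarrow>\<^sub>0 'k"

definition X :: "int \<Rightarrow> 'k::field laurent" where
  "X n = Poly_Mapping.single n 1"

lift_definition ldiff :: "'k::field laurent \<Rightarrow> 'k laurent"
  is "\<lambda>f n. of_int (n + 1) * f (n + 1)"
proof -
  fix f :: "int \<Rightarrow> 'k"
  assume "finite {n. f n \<noteq> 0}"
  then have "finite ((\<lambda>n. n - 1) ` {n. f n \<noteq> 0})" by simp
  moreover have "{n. of_int (n + 1) * f (n + 1) \<noteq> 0} \<subseteq> (\<lambda>n. n - 1) ` {n. f n \<noteq> 0}"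
  proof
    fix n assume "n \<in> {n. of_int (n + 1) * f (n + 1) \<noteq> 0}"
    then show "n \<in> (\<lambda>n. n - 1) ` {n. f n \<noteq> 0}" by (intro image_eqI[of _ _ "n + 1"]) auto
  qed
  ultimately show "finite {n. of_int (n + 1) * f (n + 1) \<noteq> 0}" by (rule rev_finite_subset)
qed

lemma ldiff_X: "ldiff (X n) = vscale (of_int n) (X (n - 1))"
  by (rule poly_mapping_eqI) (auto simp: ldiff.rep_eq X_def lookup_single when_def)

lift_definition hv :: "'k::field laurent \<Rightarrow> 'k laurent \<Rightarrow> 'k hv" is "case_sum"
proof -
  fix f g :: "int \<Rightarrow> 'k"
  assume "finite {n. f n \<noteq> 0}" "finite {n. g n \<noteq> 0}"
  then have "finite (Inl ` {n. f n \<noteq> 0} \<union> Inr ` {n. g n \<noteq> 0})" by simp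
  moreover have "{b. case_sum f g b \<noteq> 0} \<subseteq> Inl ` {n. f n \<noteq> 0} \<union> Inr ` {n. g n \<noteq> 0}"
  proof
    fix b assume "b \<in> {b. case_sum f g b \<noteq> 0}"
    then show "b \<in> Inl ` {n. f n \<noteq> 0} \<union> Inr ` {n. g n \<noteq> 0}" by (cases b) auto
  qed
  ultimately show "finite {b. case_sum f g b \<noteq> 0}" by (rule rev_finite_subset)
qed

definition hv1 :: "'k::field hv \<Rightarrow> 'k laurent" where
  "hv1 = Poly_Mapping.map_key Inl"

definition hv2 :: "'k::field hv \<Rightarrow> 'k laurent" where
  "hv2 = Poly_Mapping.map_key Inr"

lemma hv1_hv [simp]: "hv1 (hv f g) = f" and hv2_hv [simp]: "hv2 (hv f g) = g"
  by (auto intro!: poly_mapping_eqI simp: hv1_def hv2_def map_key.rep_eq hv.rep_eq)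

lemma hv_surjective: "hv (hv1 u) (hv2 u) = u"
  by (rule poly_mapping_eqI)
     (auto simp: hv1_def hv2_def map_key.rep_eq hv.rep_eq split: sum.splits)

definition hv_bracket :: "'k::field hv \<Rightarrow> 'k hv \<Rightarrow> 'k hv" where
  "hv_bracket u v =
     hv (hv1 u * ldiff (hv1 v) - hv1 v * ldiff (hv1 u))
        (hv1 u * ldiff (hv2 v) - hv1 v * ldiff (hv2 u))"

lemma vscale_X: "vscale c (X n) = Poly_Mapping.single n c"
  by (rule poly_mapping_eqI) (auto simp: X_def lookup_single when_def)

lemma vscale_hv: "vscale c (hv f g) = hv (vscale c f) (vscale c g)"
  by (rule poly_mapping_eqI) (simp add: hv.rep_eq split: sum.split)

lemma hv_bracket_basis:
  "hv_bracket (hv (X (m + 1)) 0) (hv (X (n + 1)) 0) =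
     vscale (of_int (n - m)) (hv (X (m + n + 1)) 0 :: 'k::field hv)"
  "hv_bracket (hv (X (m + 1)) 0) (hv 0 (X n)) = vscale (of_int n) (hv 0 (X (m + n)) :: 'k hv)"
  "hv_bracket (hv 0 (X m)) (hv 0 (X n)) = (0 :: 'k hv)"
proof -
  have ldiff_0: "ldiff 0 = (0 :: 'k laurent)"
    by (rule poly_mapping_eqI) (simp add: ldiff.rep_eq)
  have X_ldiff: "X a * ldiff (X b) = (Poly_Mapping.single (a + b - 1) (of_int b) :: 'k laurent)"
    for a b
    unfolding ldiff_X vscale_X unfolding X_def mult_single by (simp add: add_diff_eq)
  have idx: "m + 1 + (n + 1) - 1 = m + n + 1" "n + 1 + (m + 1) - 1 = m + n + 1"
    "m + 1 + n - 1 = m + n"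
    by simp_all
  show "hv_bracket (hv (X (m + 1)) 0) (hv (X (n + 1)) 0) =
     vscale (of_int (n - m)) (hv (X (m + n + 1)) (0 :: 'k laurent))"
    unfolding hv_bracket_def hv1_hv hv2_hv ldiff_0 X_ldiff idx vscale_hv vscale_X
    by (simp flip: single_diff)
  show "hv_bracket (hv (X (m + 1)) 0) (hv 0 (X n)) =
     vscale (of_int n) (hv 0 (X (m + n) :: 'k laurent))"
    unfolding hv_bracket_def hv1_hv hv2_hv ldiff_0 X_ldiff idx vscale_hv vscale_X
    by simp
  have "hv 0 0 = (0 :: 'k hv)"
    by (rule poly_mapping_eqI) (simp add: hv.rep_eq split: sum.split)
  then show "hv_bracket (hv 0 (X m)) (hv 0 (X n :: 'k laurent)) = 0"
    unfolding hv_bracket_def hv1_hv hv2_hv ldiff_0 by simp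
qed

definition dpair :: "('k::field laurent \<Rightarrow> 'k) \<Rightarrow> ('k laurent \<Rightarrow> 'k) \<Rightarrow> 'k hv \<Rightarrow> 'k" where
  "dpair a b u = a (hv1 u) + b (hv2 u)"

definition eps :: "int \<Rightarrow> 'k::field laurent \<Rightarrow> 'k" where
  "eps i = dual_basis i"

definition eps1 :: "int \<Rightarrow> 'k::field hv \<Rightarrow> 'k" where
  "eps1 i = dpair (eps i) 0"

definition eps2 :: "int \<Rightarrow> 'k::field hv \<Rightarrow> 'k" where
  "eps2 i = dpair 0 (eps i)"

lemma eps1_eq: "eps1 i = dual_basis (Inl i)" and eps2_eq: "eps2 i = dual_basis (Inr i)"
  by (auto simp: fun_eq_iff eps1_def eps2_def dpair_def eps_def dual_basis_def hv1_def hv2_def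
      map_key.rep_eq)

definition Acirc :: "('k::field laurent \<Rightarrow> 'k) set" where
  "Acirc = {a \<in> dual. \<exists>(r::nat) (c :: nat \<Rightarrow> 'k).
              \<forall>n::int. a (X n) = (\<Sum>j=1..r. c j * a (X (n - int j)))}"

definition Acirc_sum :: "('k::field hv \<Rightarrow> 'k) set" where
  "Acirc_sum = {dpair a b | a b. a \<in> Acirc \<and> b \<in> Acirc}"

definition cobracket_formulas ::
  "(('k::field hv \<Rightarrow> 'k) \<Rightarrow> ((int + int) \<times> (int + int) \<Rightarrow>\<^sub>0 'k) \<Rightarrow> 'k) \<Rightarrow> bool" where
  "cobracket_formulas \<Delta> \<longleftrightarrow>
     formally_linear \<Delta> \<and>
     (\<forall>p. formal_sum (\<lambda>(i, j). fscale (of_int (j - i)) (eps1 i \<otimes>\<^sub>f eps1 j))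
            {(i, j). i + j = p + 1} (\<Delta> (eps1 p))) \<and>
     (\<forall>p. formal_sum (\<lambda>(i, j). fscale (of_int j) (eps1 i \<otimes>\<^sub>f eps2 j)
                               - fscale (of_int i) (eps2 i \<otimes>\<^sub>f eps1 j))
            {(i, j). i + j = p + 1} (\<Delta> (eps2 p)))"

text \<open>The pairs not listed below (\<open>(0, \<epsilon>\<^sup>i)\<close> with \<open>(\<epsilon>\<^sup>j, 0)\<close>, and \<open>(0, \<epsilon>\<^sup>i)\<close> with \<open>(0, \<epsilon>\<^sup>m)\<close>) are covered by
  skew-symmetry.\<close>

definition bracket_formulas ::
  "int \<Rightarrow> 'k::field \<Rightarrow> (('k hv \<Rightarrow> 'k) \<Rightarrow> ('k hv \<Rightarrow> 'k) \<Rightarrow> 'k hv \<Rightarrow> 'k) \<Rightarrow> bool" where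
  "bracket_formulas m q br \<longleftrightarrow>
     formally_bilinear br \<and>
     (\<forall>f\<in>dual. \<forall>h\<in>dual. br f h = - br h f) \<and>
     (\<forall>i j. br (eps1 i) (eps1 j) = 0) \<and>
     (\<forall>i j. br (eps1 i) (eps2 j) =
        (if i = 1 then fscale (of_int m * q) (eps1 (j - m + 1))
         else if j = m then fscale (of_int (1 - i) * q) (eps1 i)
         else 0)) \<and>
     (\<forall>i j. i = m \<and> j \<noteq> m \<longrightarrow> br (eps2 i) (eps2 j) = fscale (of_int j * q) (eps2 j)) \<and>
     (\<forall>i j. i \<noteq> m \<and> j \<noteq> m \<longrightarrow> br (eps2 i) (eps2 j) = 0)"

end

theory Submission
  imports Defs
begin

text \<open>
  Both tensors are the same: the extra summand \<open>(x, 0) \<otimes> (x, 0)\<close> of the first one cancels, so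
  \<open>r = r' = a \<otimes> b - b \<otimes> a\<close> with \<open>a = (x, 0)\<close>, \<open>b = (0, q x\<^sup>m)\<close> and \<open>[a, b] = m b\<close>. For any Lie algebra and
  any \<open>a\<close>, \<open>b\<close> with \<open>[a, b] = c b\<close> such a tensor solves the classical Yang-Baxter equation, and its
  coboundary is a Lie bialgebra structure (\<open>coboundary_triangular_wedge\<close>).

  The dual operations exist on the whole dual space, and apart from closure all their axioms are
  transposes of the axioms of the given Lie bialgebra. Hence every good subspace
  that is closed under the dual bracket is a Lie bialgebra (\<open>lie_bialgebra_on_good_subspace\<close>). For a
  coboundary \<open>a \<otimes> b - b \<otimes> a\<close> the dual bracket of \<open>f\<close> and \<open>h\<close> is a linear combination of \<open>f\<close> and \<open>h\<close>
  composed with \<open>[a, -]\<close> and \<open>[b, -]\<close>, so that stability under the coadjoint action suffices.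

  It remains to see that the maximal good subspace consists of the pairs of linearly recurrent
  sequences (\<open>max_good_hv\<close>). A sequence is recurrent iff its shifts span a finite-dimensional space
  (\<open>recurrent_iff_shift_finite\<close>); therefore the coadjoint orbit of such a pair \<open>f\<close> spans a
  finite-dimensional space of pairs of the same kind, and choosing points at which the functions of
  this space are interpolated writes \<open>(u, v) \<mapsto> f [u, v]\<close> as an element of the tensor square
  (\<open>good_subspaceI\<close>). Conversely, if \<open>f\<close> lies in a good subspace then \<open>(u, v) \<mapsto> f [u, v]\<close> has finite
  rank. For the second component \<open>b\<close> of \<open>f\<close> this gives a non-constant Laurent polynomial \<open>u\<close> with
  \<open>b(u' v) = 0\<close> for all \<open>v\<close>. For the first component \<open>a\<close> it gives \<open>u\<^sub>1\<close> and \<open>u\<^sub>2\<close> of different degrees with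
  \<open>a(u\<^sub>i v' - u\<^sub>i' v) = 0\<close> for all \<open>v\<close>; putting \<open>v = u\<^sub>2 w\<close> and \<open>v = u\<^sub>1 w\<close> and subtracting yields
  \<open>2 a((u\<^sub>1 u\<^sub>2' - u\<^sub>1' u\<^sub>2) w) = 0\<close> for all \<open>w\<close>, where the Wronskian is nonzero in characteristic zero. A
  functional that vanishes on a nonzero ideal is a recurrent sequence.

  The displayed formulas are then read off on basis vectors, and they determine the operations
  because these are compatible with formal infinite linear combinations.
\<close>

section \<open>Bilinear maps, tensors and functionals\<close>

lemma vector_space_field: "vector_space ((*) :: 'k::field \<Rightarrow> 'k \<Rightarrow> 'k)"
  by unfold_locales (auto simp: algebra_simps)

lemma linear_vscale_iff:
  "Vector_Spaces.linear vscale vscale g \<longleftrightarrow>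
     (\<forall>x y. g (x + y) = g x + g y) \<and> (\<forall>c x. g (vscale c x) = vscale c (g x))"
  by (auto simp: Vector_Spaces.linear_iff vs.vector_space_axioms)

lemma dual_iff:
  "f \<in> dual \<longleftrightarrow> (\<forall>x y. f (x + y) = f x + f y) \<and> (\<forall>c x. f (vscale c x) = c * f x)"
  by (auto simp: dual_def Vector_Spaces.linear_iff vs.vector_space_axioms vector_space_field)

lemma bilinear_maps_iff:
  assumes "vector_space s"
  shows "\<beta> \<in> bilinear_maps s \<longleftrightarrow>
     (\<forall>u v w. \<beta> u (v + w) = \<beta> u v + \<beta> u w) \<and> (\<forall>u v w. \<beta> (u + v) w = \<beta> u w + \<beta> v w) \<and>
     (\<forall>c u v. \<beta> u (vscale c v) = s c (\<beta> u v)) \<and> (\<forall>c u v. \<beta> (vscale c u) v = s c (\<beta> u v))"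
  by (auto simp: bilinear_maps_def Vector_Spaces.linear_iff vs.vector_space_axioms assms)

lemmas bilinear_maps_vscale_iff = bilinear_maps_iff[OF vs.vector_space_axioms]
lemmas bilinear_maps_field_iff = bilinear_maps_iff[OF vector_space_field]

lemma dual_add: "f \<in> dual \<Longrightarrow> f (x + y) = f x + f y"
  and dual_scale: "f \<in> dual \<Longrightarrow> f (vscale c x) = c * f x"
  by (auto simp: dual_iff)

lemma vscale_zero_left [simp]: "vscale 0 x = 0"
  and vscale_minus_one: "vscale (-1) x = - x"
  by (auto intro!: poly_mapping_eqI)

lemma dual_zero: "f \<in> dual \<Longrightarrow> f 0 = 0"
  using dual_scale[of f 0 0] by simp

lemma dual_minus: "f \<in> dual \<Longrightarrow> f (- x) = - f x"
  using dual_scale[of f "-1" x] by (simp add: vscale_minus_one)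

lemma dual_diff: "f \<in> dual \<Longrightarrow> f (x - y) = f x - f y"
  using dual_add[of f x "- y"] by (simp add: dual_minus)

lemma dual_expand:
  assumes "f \<in> dual"
  shows "f v = (\<Sum>b\<in>Poly_Mapping.keys v. Poly_Mapping.lookup v b * f (basis b))"
  using linear_expand[of "(*)" f v] assms by (simp add: dual_def)

lemma dual_eqI:
  assumes "f \<in> dual" "g \<in> dual" "\<And>b. f (basis b) = g (basis b)"
  shows "f = g"
proof
  fix v
  show "f v = g v"
    by (subst dual_expand[OF assms(1)], subst dual_expand[OF assms(2)]) (simp add: assms(3))
qed

lemma dual_eqI_tensor:
  assumes "f \<in> dual" "g \<in> dual" "\<And>u v. f (u \<otimes>\<^sub>t v) = g (u \<otimes>\<^sub>t v)"
  shows "f = g"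
proof (rule dual_eqI)
  fix b :: "'a \<times> 'b"
  show "f (basis b) = g (basis b)"
    using assms(3)[of "basis (fst b)" "basis (snd b)"] by (simp add: basis_tensor_basis)
qed (use assms in auto)

lemma dual_eqI_tensor3:
  assumes "f \<in> dual" "g \<in> dual" "\<And>u v w. f (u \<otimes>\<^sub>t v \<otimes>\<^sub>t w) = g (u \<otimes>\<^sub>t v \<otimes>\<^sub>t w)"
  shows "f = g"
proof (rule dual_eqI)
  fix b :: "'a \<times> 'b \<times> 'c"
  show "f (basis b) = g (basis b)"
    using assms(3)[of "basis (fst b)" "basis (fst (snd b))" "basis (snd (snd b))"]
    by (simp add: basis_tensor_basis)
qed (use assms in auto)

lemma subspace_dual: "fs.subspace dual"
  by (auto simp: fs.subspace_def dual_iff fscale_def algebra_simps)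

lemma dual_comp: "f \<in> dual \<Longrightarrow> Vector_Spaces.linear vscale vscale g \<Longrightarrow> f \<circ> g \<in> dual"
  by (auto simp: dual_iff linear_vscale_iff)

lemma fun_add_in_dual: "f \<in> dual \<Longrightarrow> g \<in> dual \<Longrightarrow> f + g \<in> dual"
  and fun_diff_in_dual: "f \<in> dual \<Longrightarrow> g \<in> dual \<Longrightarrow> f - g \<in> dual"
  and fun_scale_in_dual: "f \<in> dual \<Longrightarrow> fscale c f \<in> dual"
  and zero_in_dual: "0 \<in> dual"
  by (simp_all add: dual_iff fscale_def algebra_simps)

lemma dual_basis_in_dual: "dual_basis b \<in> dual"
  by (auto simp: dual_iff dual_basis_def lookup_add)

lemma dual_basis_basis: "dual_basis b (basis c) = (if b = c then 1 else 0)"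
  by (auto simp: dual_basis_def basis_def lookup_single when_def)

lemma tensor_add_left: "(u + v) \<otimes>\<^sub>t w = u \<otimes>\<^sub>t w + v \<otimes>\<^sub>t w"
  and tensor_add_right: "w \<otimes>\<^sub>t (u + v) = w \<otimes>\<^sub>t u + w \<otimes>\<^sub>t v"
  and tensor_diff_left: "(u - v) \<otimes>\<^sub>t w = u \<otimes>\<^sub>t w - v \<otimes>\<^sub>t w"
  and tensor_diff_right: "w \<otimes>\<^sub>t (u - v) = w \<otimes>\<^sub>t u - w \<otimes>\<^sub>t v"
  and tensor_minus_left: "(- u) \<otimes>\<^sub>t w = - (u \<otimes>\<^sub>t w)"
  and tensor_minus_right: "w \<otimes>\<^sub>t (- u) = - (w \<otimes>\<^sub>t u)"
  and tensor_scale_left: "vscale c u \<otimes>\<^sub>t w = vscale c (u \<otimes>\<^sub>t w)"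
  and tensor_scale_right: "w \<otimes>\<^sub>t vscale c u = vscale c (w \<otimes>\<^sub>t u)"
  and tensor_zero_left: "0 \<otimes>\<^sub>t w = 0"
  and tensor_zero_right: "w \<otimes>\<^sub>t 0 = 0"
  by (auto intro!: poly_mapping_eqI simp: tensor.rep_eq lookup_add lookup_minus algebra_simps)

lemmas tensor_linear = tensor_add_left tensor_add_right tensor_diff_left tensor_diff_right
  tensor_minus_left tensor_minus_right tensor_scale_left tensor_scale_right
  tensor_zero_left tensor_zero_right

lemmas vscale_linear = vs.scale_right_distrib vs.scale_right_diff_distrib vs.scale_minus_right
  vs.scale_scale

lemma tlift_add: "tlift vscale \<beta> (t + u) = tlift vscale \<beta> t + tlift vscale \<beta> u"
  and tlift_scale: "tlift vscale \<beta> (vscale c t) = vscale c (tlift vscale \<beta> t)"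
  using linear_tlift[OF vs.vector_space_axioms, of \<beta>] by (auto simp: linear_vscale_iff)

lemma tlift_minus: "tlift vscale \<beta> (- t) = - tlift vscale \<beta> t"
  using tlift_scale[of \<beta> "-1" t] by (simp add: vscale_minus_one)

lemma tlift_diff: "tlift vscale \<beta> (t - u) = tlift vscale \<beta> t - tlift vscale \<beta> u"
  using tlift_add[of \<beta> t "- u"] by (simp add: tlift_minus)

lemma tlift_zero: "tlift vscale \<beta> 0 = 0"
  using tlift_scale[of \<beta> 0 0] by simp

lemmas tlift_linear = tlift_add tlift_scale tlift_minus tlift_diff tlift_zero

lemmas tlift_vscale_tensor = tlift_tensor[OF vs.vector_space_axioms]

lemmas linear_tlift_vscale = linear_tlift[OF vs.vector_space_axioms]

lemma ftensor_in_dual: "f \<otimes>\<^sub>f h \<in> dual"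
  by (simp add: ftensor_def dual_def linear_tlift vector_space_field)

lemma ftensor_tensor: "f \<in> dual \<Longrightarrow> h \<in> dual \<Longrightarrow> (f \<otimes>\<^sub>f h) (u \<otimes>\<^sub>t v) = f u * h v"
  unfolding ftensor_def
  by (rule tlift_tensor) (auto simp: vector_space_field bilinear_maps_field_iff dual_iff algebra_simps)

lemma ftensor_basis: "(f \<otimes>\<^sub>f h) (basis (b, c)) = f (basis b) * h (basis c)"
  unfolding ftensor_def tlift_def by (simp add: basis_def)

lemma ftensor_add_left: "(f + g) \<otimes>\<^sub>f h = f \<otimes>\<^sub>f h + g \<otimes>\<^sub>f h"
  and ftensor_add_right: "h \<otimes>\<^sub>f (f + g) = h \<otimes>\<^sub>f f + h \<otimes>\<^sub>f g"
  and ftensor_scale_left: "fscale c f \<otimes>\<^sub>f h = fscale c (f \<otimes>\<^sub>f h)"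
  and ftensor_scale_right: "h \<otimes>\<^sub>f fscale c f = fscale c (h \<otimes>\<^sub>f f)"
  and ftensor_zero_right: "h \<otimes>\<^sub>f 0 = 0"
  by (auto simp: ftensor_def tlift_def fun_eq_iff fscale_def algebra_simps sum.distrib
      sum_distrib_left case_prod_unfold)

lemma ftensor_twist:
  assumes "f \<in> dual" "h \<in> dual"
  shows "(f \<otimes>\<^sub>f h) (twist t) = (h \<otimes>\<^sub>f f) t"
proof -
  have "(f \<otimes>\<^sub>f h) \<circ> twist = h \<otimes>\<^sub>f f"
    by (rule dual_eqI_tensor)
       (auto intro!: dual_comp ftensor_in_dual linear_tlift_vscale simp: twist_def ftensor_tensor assms
         tlift_vscale_tensor bilinear_maps_vscale_iff tensor_linear)
  then show ?thesis by (auto simp: fun_eq_iff)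
qed

lemma twist_tensor: "twist (u \<otimes>\<^sub>t v) = v \<otimes>\<^sub>t u"
  unfolding twist_def
  by (rule tlift_vscale_tensor) (auto simp: bilinear_maps_vscale_iff tensor_linear)

lemma linear_twist: "Vector_Spaces.linear vscale vscale twist"
  unfolding twist_def by (rule linear_tlift_vscale)

lemma linear_cyc: "Vector_Spaces.linear vscale vscale cyc"
  unfolding cyc_def by (rule linear_tlift_vscale)

lemma cyc_tensor: "cyc (u \<otimes>\<^sub>t v \<otimes>\<^sub>t w) = v \<otimes>\<^sub>t w \<otimes>\<^sub>t u"
proof -
  have inner: "(\<lambda>y z. y \<otimes>\<^sub>t z \<otimes>\<^sub>t x) \<in> bilinear_maps vscale" for x
    by (auto simp: bilinear_maps_vscale_iff tensor_linear)
  have "tlift vscale (\<lambda>y z. y \<otimes>\<^sub>t z \<otimes>\<^sub>t (x + x')) t =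
      tlift vscale (\<lambda>y z. y \<otimes>\<^sub>t z \<otimes>\<^sub>t x) t + tlift vscale (\<lambda>y z. y \<otimes>\<^sub>t z \<otimes>\<^sub>t x') t"
    "tlift vscale (\<lambda>y z. y \<otimes>\<^sub>t z \<otimes>\<^sub>t vscale c x) t = vscale c (tlift vscale (\<lambda>y z. y \<otimes>\<^sub>t z \<otimes>\<^sub>t x) t)"
    for x x' c and t :: "'a \<times> 'a \<Rightarrow>\<^sub>0 'b"
    by (auto simp: tlift_def tensor_linear vscale_linear sum.distrib case_prod_unfold
        vs.scale_sum_right mult.commute)
  then have "cyc (u \<otimes>\<^sub>t v \<otimes>\<^sub>t w) = tlift vscale (\<lambda>y z. y \<otimes>\<^sub>t z \<otimes>\<^sub>t u) (v \<otimes>\<^sub>t w)"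
    unfolding cyc_def
    by (intro tlift_vscale_tensor) (auto simp: bilinear_maps_vscale_iff tlift_linear)
  also have "\<dots> = v \<otimes>\<^sub>t w \<otimes>\<^sub>t u"
    by (rule tlift_vscale_tensor) (rule inner)
  finally show ?thesis .
qed

section \<open>Triangular structures from a two-dimensional subalgebra\<close>

lemma lie_algebra_bilinear: "lie_algebra \<phi> \<Longrightarrow> \<phi> \<in> bilinear_maps vscale"
  and lie_algebra_self: "lie_algebra \<phi> \<Longrightarrow> \<phi> x x = 0"
  and lie_algebra_jacobi: "lie_algebra \<phi> \<Longrightarrow> \<phi> x (\<phi> y z) + \<phi> y (\<phi> z x) + \<phi> z (\<phi> x y) = 0"
  by (simp_all add: lie_algebra_def)

lemma bilinear_zero_left: "\<phi> \<in> bilinear_maps vscale \<Longrightarrow> \<phi> 0 x = 0"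
  and bilinear_zero_right: "\<phi> \<in> bilinear_maps vscale \<Longrightarrow> \<phi> x 0 = 0"
  by (metis bilinear_maps_vscale_iff vscale_zero_left)+

lemma bilinear_minus_left: "\<phi> \<in> bilinear_maps vscale \<Longrightarrow> \<phi> (- x) y = - \<phi> x y"
  and bilinear_minus_right: "\<phi> \<in> bilinear_maps vscale \<Longrightarrow> \<phi> y (- x) = - \<phi> y x"
  by (metis bilinear_maps_vscale_iff vscale_minus_one)+

lemma bilinear_linear:
  assumes "\<phi> \<in> bilinear_maps vscale"
  shows "\<phi> (x + y) z = \<phi> x z + \<phi> y z" "\<phi> z (x + y) = \<phi> z x + \<phi> z y"
    "\<phi> (x - y) z = \<phi> x z - \<phi> y z" "\<phi> z (x - y) = \<phi> z x - \<phi> z y"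
    "\<phi> (vscale c x) z = vscale c (\<phi> x z)" "\<phi> z (vscale c x) = vscale c (\<phi> z x)"
    "\<phi> (- x) z = - \<phi> x z" "\<phi> z (- x) = - \<phi> z x" "\<phi> 0 z = 0" "\<phi> z 0 = 0"
  using assms bilinear_minus_left[OF assms] bilinear_minus_right[OF assms]
    bilinear_zero_left[OF assms] bilinear_zero_right[OF assms]
  by (auto simp: bilinear_maps_vscale_iff simp del: add_uminus_conv_diff
      simp add: diff_conv_add_uminus)

lemma lie_algebra_skew:
  assumes "lie_algebra \<phi>"
  shows "\<phi> x y = - \<phi> y x"
proof -
  note lin = bilinear_linear[OF lie_algebra_bilinear[OF assms]]
  have "\<phi> (x + y) (x + y) = 0" by (rule lie_algebra_self[OF assms])
  then have "\<phi> x y + \<phi> y x = 0"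
    by (simp add: lin lie_algebra_self[OF assms, of x] lie_algebra_self[OF assms, of y] add.commute)
  then show ?thesis by (simp add: eq_neg_iff_add_eq_0)
qed

lemma lie_algebra_ad_bracket:
  assumes "lie_algebra \<phi>"
  shows "\<phi> (\<phi> x y) z = \<phi> x (\<phi> y z) - \<phi> y (\<phi> x z)"
proof -
  note lin = bilinear_linear[OF lie_algebra_bilinear[OF assms]]
  have "\<phi> x (\<phi> y z) + \<phi> y (\<phi> z x) + \<phi> z (\<phi> x y) = 0"
    by (rule lie_algebra_jacobi[OF assms])
  moreover have "\<phi> z (\<phi> x y) = - \<phi> (\<phi> x y) z" "\<phi> y (\<phi> z x) = - \<phi> y (\<phi> x z)"
    using lie_algebra_skew[OF assms, of z] by (simp_all add: lin)
  ultimately show ?thesis by (simp add: algebra_simps)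
qed

lemma act_tensor:
  assumes "\<phi> \<in> bilinear_maps vscale"
  shows "act \<phi> x (u \<otimes>\<^sub>t v) = \<phi> x u \<otimes>\<^sub>t v + u \<otimes>\<^sub>t \<phi> x v"
  unfolding act_def
  by (rule tlift_vscale_tensor)
     (simp add: bilinear_maps_vscale_iff tensor_linear vscale_linear bilinear_linear[OF assms])

lemma act_linear:
  "act \<phi> x (t + u) = act \<phi> x t + act \<phi> x u"
  "act \<phi> x (t - u) = act \<phi> x t - act \<phi> x u"
  "act \<phi> x (- t) = - act \<phi> x t"
  "act \<phi> x (vscale c t) = vscale c (act \<phi> x t)"
  by (simp_all add: act_def tlift_linear)

lemma twist_linear:
  "twist (t + u) = twist t + twist u" "twist (t - u) = twist t - twist u"
  "twist (- t) = - twist t" "twist (vscale c t) = vscale c (twist t)"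
  by (simp_all add: twist_def tlift_linear)

lemma cyc_linear:
  "cyc (t + u) = cyc t + cyc u" "cyc (t - u) = cyc t - cyc u"
  "cyc (- t) = - cyc t" "cyc (vscale c t) = vscale c (cyc t)" "cyc 0 = 0"
  by (simp_all add: cyc_def tlift_linear)

lemma coboundary_wedge:
  assumes "\<phi> \<in> bilinear_maps vscale"
  shows "coboundary \<phi> (a \<otimes>\<^sub>t b - b \<otimes>\<^sub>t a) z =
    \<phi> z a \<otimes>\<^sub>t b + a \<otimes>\<^sub>t \<phi> z b - \<phi> z b \<otimes>\<^sub>t a - b \<otimes>\<^sub>t \<phi> z a"
  by (simp add: coboundary_def act_linear act_tensor[OF assms])

text \<open>
  For \<open>r = a \<otimes> b - b \<otimes> a\<close> the three summands of the Yang-Baxter equation only involve \<open>[a, b] = c b\<close>,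
  and the resulting tensors in \<open>a\<close> and \<open>b\<close> cancel.
\<close>

lemma CYBE_wedge:
  assumes lie: "lie_algebra \<phi>" and ab: "\<phi> a b = vscale c b"
  shows "CYBE \<phi> (a \<otimes>\<^sub>t b - b \<otimes>\<^sub>t a)"
proof -
  note lin = bilinear_linear[OF lie_algebra_bilinear[OF lie]]
  have ba: "\<phi> b a = - vscale c b" using ab lie_algebra_skew[OF lie, of b a] by simp
  have expand: "tlift vscale (\<lambda>u v. tlift vscale (\<beta> u v) (a \<otimes>\<^sub>t b - b \<otimes>\<^sub>t a)) (a \<otimes>\<^sub>t b - b \<otimes>\<^sub>t a) =
      \<beta> a b a b - \<beta> a b b a - (\<beta> b a a b - \<beta> b a b a)"
    if *: "\<And>u v. \<beta> u v \<in> bilinear_maps vscale" "\<And>s t. (\<lambda>u v. \<beta> u v s t) \<in> bilinear_maps vscale"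
    for \<beta> :: "('a \<Rightarrow>\<^sub>0 'b) \<Rightarrow> ('a \<Rightarrow>\<^sub>0 'b) \<Rightarrow> ('a \<Rightarrow>\<^sub>0 'b) \<Rightarrow> ('a \<Rightarrow>\<^sub>0 'b) \<Rightarrow> ('a \<times> 'a \<times> 'a \<Rightarrow>\<^sub>0 'b)"
  proof -
    have "(\<lambda>u v. \<beta> u v a b - \<beta> u v b a) \<in> bilinear_maps vscale"
      using *(2) by (simp add: bilinear_maps_vscale_iff vscale_linear algebra_simps)
    then show ?thesis
      by (simp add: tlift_diff tlift_vscale_tensor *)
  qed
  have bil: "(\<lambda>c' d. \<phi> u c' \<otimes>\<^sub>t v \<otimes>\<^sub>t d) \<in> bilinear_maps vscale"
    "(\<lambda>u v. \<phi> u s \<otimes>\<^sub>t v \<otimes>\<^sub>t t) \<in> bilinear_maps vscale"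
    "(\<lambda>c' d. u \<otimes>\<^sub>t \<phi> v c' \<otimes>\<^sub>t d) \<in> bilinear_maps vscale"
    "(\<lambda>u v. u \<otimes>\<^sub>t \<phi> v s \<otimes>\<^sub>t t) \<in> bilinear_maps vscale"
    "(\<lambda>c' d. u \<otimes>\<^sub>t c' \<otimes>\<^sub>t \<phi> v d) \<in> bilinear_maps vscale"
    "(\<lambda>u v. u \<otimes>\<^sub>t s \<otimes>\<^sub>t \<phi> v t) \<in> bilinear_maps vscale" for u v s t
    by (simp_all add: bilinear_maps_vscale_iff lin tensor_linear)
  show ?thesis
    unfolding CYBE_def
    by (simp add: expand[OF bil(1,2)] expand[OF bil(3,4)] expand[OF bil(5,6)]
        ab ba lie_algebra_self[OF lie] tensor_linear vscale_linear)
qed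

text \<open>
  With \<open>A = [x, a]\<close> and \<open>B = [x, b]\<close>, the terms of the co-Jacobi expression of \<open>x\<close> that survive cyclic
  summation add up to the alternating tensor of \<open>a\<close>, \<open>b\<close> and \<open>[A, b] - [B, a] - c B\<close>. The last
  argument vanishes by the Jacobi identity.
\<close>

lemma lie_bialgebra_wedge:
  assumes lie: "lie_algebra \<phi>" and ab: "\<phi> a b = vscale c b"
  shows "lie_bialgebra \<phi> (coboundary \<phi> (a \<otimes>\<^sub>t b - b \<otimes>\<^sub>t a))"
proof -
  note bil = lie_algebra_bilinear[OF lie]
  note lin = bilinear_linear[OF bil]
  note ad = lie_algebra_ad_bracket[OF lie]
  define \<delta> where "\<delta> = coboundary \<phi> (a \<otimes>\<^sub>t b - b \<otimes>\<^sub>t a)"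
  have \<delta>: "\<delta> z = \<phi> z a \<otimes>\<^sub>t b + a \<otimes>\<^sub>t \<phi> z b - \<phi> z b \<otimes>\<^sub>t a - b \<otimes>\<^sub>t \<phi> z a" for z
    unfolding \<delta>_def by (rule coboundary_wedge[OF bil])
  have ba: "\<phi> b a = - vscale c b" using ab lie_algebra_skew[OF lie, of b a] by simp
  have "Vector_Spaces.linear vscale vscale \<delta>"
    by (simp add: linear_vscale_iff \<delta> lin tensor_linear vscale_linear algebra_simps)
  moreover have "\<exists>t. \<delta> x = t - twist t" for x
    by (rule exI[of _ "\<phi> x a \<otimes>\<^sub>t b + a \<otimes>\<^sub>t \<phi> x b"]) (simp add: \<delta> twist_linear twist_tensor)
  moreover have "t + cyc t + cyc (cyc t) = 0"
    if t: "t = tlift vscale (\<lambda>y z. y \<otimes>\<^sub>t \<delta> z) (\<delta> x)" for t x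
  proof -
    define A B where "A = \<phi> x a" and "B = \<phi> x b"
    have \<beta>: "(\<lambda>y z. y \<otimes>\<^sub>t \<delta> z) \<in> bilinear_maps vscale"
      by (simp add: bilinear_maps_vscale_iff \<delta> lin tensor_linear vscale_linear algebra_simps)
    have t': "t = A \<otimes>\<^sub>t \<delta> b + a \<otimes>\<^sub>t \<delta> B - B \<otimes>\<^sub>t \<delta> a - b \<otimes>\<^sub>t \<delta> A"
      unfolding t \<delta>[of x] A_def[symmetric] B_def[symmetric]
      by (simp add: tlift_linear tlift_vscale_tensor[OF \<beta>])
    have Ab: "\<phi> A b = \<phi> B a + vscale c B"
    proof -
      have "\<phi> A b = \<phi> x (\<phi> a b) - \<phi> a B" unfolding A_def B_def by (rule ad)
      then show ?thesis
        using lie_algebra_skew[OF lie, of a B] by (simp add: ab lin B_def)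
    qed
    show ?thesis
      unfolding t' \<delta>
      by (simp add: Ab ab ba lie_algebra_self[OF lie] tensor_linear vscale_linear
          cyc_linear cyc_tensor)
  qed
  moreover have "\<delta> (\<phi> x y) = act \<phi> x (\<delta> y) - act \<phi> y (\<delta> x)" for x y
    by (simp add: \<delta> act_linear act_tensor[OF bil] ad tensor_linear algebra_simps)
  ultimately show ?thesis
    unfolding \<delta>_def[symmetric] lie_bialgebra_def lie_coalgebra_def
    using lie by (auto simp: Let_def)
qed

lemma coboundary_triangular_wedge:
  assumes "lie_algebra \<phi>" and "\<phi> a b = vscale c b"
  shows "coboundary_triangular \<phi> (coboundary \<phi> (a \<otimes>\<^sub>t b - b \<otimes>\<^sub>t a)) (a \<otimes>\<^sub>t b - b \<otimes>\<^sub>t a)"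
  using lie_bialgebra_wedge[OF assms] CYBE_wedge[OF assms]
  by (simp add: coboundary_triangular_def)

section \<open>Dualizing a Lie bialgebra\<close>

lemma dual_map_in_dual: "f \<in> dual \<Longrightarrow> dual_map \<phi> f \<in> dual"
  unfolding dual_map_def by (intro dual_comp linear_tlift_vscale)

lemma dual_map_tensor:
  assumes "\<phi> \<in> bilinear_maps vscale"
  shows "dual_map \<phi> f (u \<otimes>\<^sub>t v) = f (\<phi> u v)"
  by (simp add: dual_map_def tlift_vscale_tensor[OF assms])

lemma lie_coalgebra_linear: "lie_coalgebra \<delta> \<Longrightarrow> Vector_Spaces.linear vscale vscale \<delta>"
  by (simp add: lie_coalgebra_def)

lemma dual_bracket_in_dual:
  "Vector_Spaces.linear vscale vscale \<delta> \<Longrightarrow> dual_bracket \<delta> f h \<in> dual"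
  unfolding dual_bracket_def by (intro dual_comp ftensor_in_dual)

lemma dual_bracket_skew:
  assumes "lie_coalgebra \<delta>" "f \<in> dual" "h \<in> dual"
  shows "dual_bracket \<delta> f h = - dual_bracket \<delta> h f"
proof
  fix x
  obtain t where "\<delta> x = t - twist t" using assms(1) by (auto simp: lie_coalgebra_def)
  then show "dual_bracket \<delta> f h x = (- dual_bracket \<delta> h f) x"
    by (simp add: dual_bracket_def dual_diff[OF ftensor_in_dual] ftensor_twist assms(2,3))
qed

lemma dual_bracket_self:
  assumes "lie_coalgebra \<delta>" "f \<in> dual"
  shows "dual_bracket \<delta> f f = 0"
proof
  fix x
  obtain t where "\<delta> x = t - twist t" using assms(1) by (auto simp: lie_coalgebra_def)
  then show "dual_bracket \<delta> f f x = 0 x"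
    by (simp add: dual_bracket_def dual_diff[OF ftensor_in_dual] ftensor_twist assms(2))
qed

text \<open>
  A nested dual bracket is a triple tensor of functionals applied to \<open>(1 \<otimes> \<delta>) (\<delta> x)\<close>, and rotating the
  functionals amounts to rotating the argument.
\<close>

lemma dual_bracket_jacobi:
  assumes \<delta>: "lie_coalgebra \<delta>" and f: "f \<in> dual" and g: "g \<in> dual" and h: "h \<in> dual"
  shows "dual_bracket \<delta> f (dual_bracket \<delta> g h) + dual_bracket \<delta> g (dual_bracket \<delta> h f)
       + dual_bracket \<delta> h (dual_bracket \<delta> f g) = 0"
proof
  fix x
  note lin = lie_coalgebra_linear[OF \<delta>]
  define t where "t = tlift vscale (\<lambda>y z. y \<otimes>\<^sub>t \<delta> z) (\<delta> x)"
  have cocycle: "t + cyc t + cyc (cyc t) = 0"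
    using \<delta> unfolding lie_coalgebra_def t_def by (simp add: Let_def)
  have \<beta>: "(\<lambda>y z. y \<otimes>\<^sub>t \<delta> z) \<in> bilinear_maps vscale"
    using lin by (simp add: bilinear_maps_vscale_iff linear_vscale_iff tensor_linear)
  have nested: "dual_bracket \<delta> f' (dual_bracket \<delta> g' h') x = (f' \<otimes>\<^sub>f g' \<otimes>\<^sub>f h') t"
    if "f' \<in> dual" for f' g' h'
  proof -
    have "f' \<otimes>\<^sub>f dual_bracket \<delta> g' h' = (f' \<otimes>\<^sub>f g' \<otimes>\<^sub>f h') \<circ> tlift vscale (\<lambda>y z. y \<otimes>\<^sub>t \<delta> z)"
      by (rule dual_eqI_tensor)
         (auto intro!: ftensor_in_dual dual_comp linear_tlift_vscale
           simp: ftensor_tensor that ftensor_in_dual dual_bracket_in_dual[OF lin]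
             tlift_vscale_tensor[OF \<beta>],
          simp add: dual_bracket_def)
    then show ?thesis by (simp add: dual_bracket_def t_def)
  qed
  have rotate: "(f' \<otimes>\<^sub>f g' \<otimes>\<^sub>f h') (cyc s) = (h' \<otimes>\<^sub>f f' \<otimes>\<^sub>f g') s"
    if "f' \<in> dual" "g' \<in> dual" "h' \<in> dual" for f' g' h' and s :: "'a \<times> 'a \<times> 'a \<Rightarrow>\<^sub>0 'b"
  proof -
    have "(f' \<otimes>\<^sub>f g' \<otimes>\<^sub>f h') \<circ> cyc = h' \<otimes>\<^sub>f f' \<otimes>\<^sub>f g'"
      by (rule dual_eqI_tensor3)
         (auto intro!: ftensor_in_dual dual_comp linear_cyc simp: ftensor_tensor that ftensor_in_dual cyc_tensor)
    then show ?thesis by (auto simp: fun_eq_iff)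
  qed
  have "0 = (f \<otimes>\<^sub>f g \<otimes>\<^sub>f h) (t + cyc t + cyc (cyc t))"
    unfolding cocycle by (simp add: dual_zero ftensor_in_dual)
  also have "\<dots> = (f \<otimes>\<^sub>f g \<otimes>\<^sub>f h) t + (h \<otimes>\<^sub>f f \<otimes>\<^sub>f g) t + (g \<otimes>\<^sub>f h \<otimes>\<^sub>f f) t"
    by (simp add: dual_add[OF ftensor_in_dual] rotate f g h)
  finally show "(dual_bracket \<delta> f (dual_bracket \<delta> g h) + dual_bracket \<delta> g (dual_bracket \<delta> h f)
       + dual_bracket \<delta> h (dual_bracket \<delta> f g)) x = 0 x"
    by (simp add: nested f g h algebra_simps)
qed

lemma represents_tensor:
  assumes "represents C ps t" "C \<subseteq> dual"
  shows "t (u \<otimes>\<^sub>t v) = (\<Sum>(y, z)\<leftarrow>ps. y u * z v)"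
proof -
  have "(\<Sum>(y, z)\<leftarrow>qs. y \<otimes>\<^sub>f z) (u \<otimes>\<^sub>t v) = (\<Sum>(y, z)\<leftarrow>qs. y u * z v)"
    if "set qs \<subseteq> C \<times> C" for qs
    using that assms(2) by (induction qs) (auto simp: ftensor_tensor subset_iff)
  then show ?thesis using assms(1) by (simp add: represents_def)
qed

lemma dual_map_cojacobi:
  assumes lie: "lie_algebra \<phi>" and f: "f \<in> dual" and C: "C \<subseteq> dual"
    and ps: "represents C ps (dual_map \<phi> f)"
    and t: "t = (\<Sum>(y, z)\<leftarrow>ps. y \<otimes>\<^sub>f dual_map \<phi> z)"
  shows "t + (t \<circ> cyc) + (t \<circ> cyc \<circ> cyc) = 0"
proof -
  note bil = lie_algebra_bilinear[OF lie]
  have sets: "set ps \<subseteq> dual \<times> dual" using ps C by (auto simp: represents_def)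
  then have "t \<in> dual \<and> t (u \<otimes>\<^sub>t v \<otimes>\<^sub>t w) = (\<Sum>(y, z)\<leftarrow>ps. y u * z (\<phi> v w))" for u v w
    unfolding t
    by (induction ps)
       (auto simp: ftensor_tensor dual_map_in_dual dual_map_tensor[OF bil]
         intro!: fun_add_in_dual ftensor_in_dual zero_in_dual)
  then have td: "t \<in> dual" and "t (u \<otimes>\<^sub>t v \<otimes>\<^sub>t w) = f (\<phi> u (\<phi> v w))" for u v w
    using represents_tensor[OF ps C, of u "\<phi> v w"] by (auto simp: dual_map_tensor[OF bil])
  then have "(t + (t \<circ> cyc) + (t \<circ> cyc \<circ> cyc)) (u \<otimes>\<^sub>t v \<otimes>\<^sub>t w) =
      f (\<phi> u (\<phi> v w) + \<phi> v (\<phi> w u) + \<phi> w (\<phi> u v))" for u v w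
    by (simp add: cyc_tensor dual_add[OF f])
  moreover have "t + (t \<circ> cyc) + (t \<circ> cyc \<circ> cyc) \<in> dual"
    using td by (intro fun_add_in_dual dual_comp linear_cyc)
  ultimately show ?thesis
    by (intro dual_eqI_tensor3) (auto simp: zero_in_dual lie_algebra_jacobi[OF lie] dual_zero[OF f])
qed

text \<open>
  Evaluated at \<open>x \<otimes> y\<close>, the left-hand side is \<open>(f \<otimes> h) (x \<cdot> \<delta> y - y \<cdot> \<delta> x)\<close>. Expanding the action gives
  four terms \<open>(k \<otimes> (l \<circ> [z, -])) (\<delta> w)\<close> up to the order of the factors, which skew-symmetry of
  \<open>\<phi>\<close> and \<open>\<delta>\<close> matches with the four terms on the right-hand side.
\<close>

lemma dual_map_dual_bracket:
  assumes bialg: "lie_bialgebra \<phi> \<delta>" and f: "f \<in> dual" and h: "h \<in> dual" and C: "C \<subseteq> dual"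
    and ps: "represents C ps (dual_map \<phi> f)" and qs: "represents C qs (dual_map \<phi> h)"
  shows "dual_map \<phi> (dual_bracket \<delta> f h) =
    fact_on (dual_bracket \<delta>) f qs - fact_on (dual_bracket \<delta>) h ps"
proof -
  have lie: "lie_algebra \<phi>" and co: "lie_coalgebra \<delta>"
    and cocycle: "\<And>x y. \<delta> (\<phi> x y) = act \<phi> x (\<delta> y) - act \<phi> y (\<delta> x)"
    using bialg by (auto simp: lie_bialgebra_def)
  note bil = lie_algebra_bilinear[OF lie] and lin = lie_coalgebra_linear[OF co]
  note skew = lie_algebra_skew[OF lie]
  have fact: "fact_on (dual_bracket \<delta>) k rs \<in> dual \<and>
      fact_on (dual_bracket \<delta>) k rs (x \<otimes>\<^sub>t y) =
        (k \<otimes>\<^sub>f (\<lambda>w. l (\<phi> w y))) (\<delta> x) + (k \<otimes>\<^sub>f (\<lambda>w. l (\<phi> x w))) (\<delta> y)"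
    if k: "k \<in> dual" and rs: "represents C rs (dual_map \<phi> l)" for k l rs x y
  proof -
    have val: "l (\<phi> u v) = (\<Sum>(y, z)\<leftarrow>rs. y u * z v)" for u v
      using represents_tensor[OF rs C, of u v] by (simp add: dual_map_tensor[OF bil])
    \<comment> \<open>Before \<open>val\<close> is used, the list can be arbitrary, which permits induction.\<close>
    have "fact_on (dual_bracket \<delta>) k ss \<in> dual \<and>
       fact_on (dual_bracket \<delta>) k ss (x \<otimes>\<^sub>t y) =
        (k \<otimes>\<^sub>f (\<lambda>w. (\<Sum>(a, b)\<leftarrow>ss. a w * b y))) (\<delta> x) + (k \<otimes>\<^sub>f (\<lambda>w. (\<Sum>(a, b)\<leftarrow>ss. a x * b w))) (\<delta> y)"
      if "set ss \<subseteq> dual \<times> dual" for ss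
      using that
    proof (induction ss)
      case Nil
      then show ?case
        by (simp add: fact_on_def zero_in_dual ftensor_zero_right flip: zero_fun_def)
    next
      case (Cons p ss)
      obtain a b where p: "p = (a, b)" by (cases p)
      with Cons.prems have a: "a \<in> dual" and b: "b \<in> dual" by auto
      have "(\<lambda>w. \<Sum>(a, b)\<leftarrow>p # ss. a w * b y) = fscale (b y) a + (\<lambda>w. \<Sum>(a, b)\<leftarrow>ss. a w * b y)"
        "(\<lambda>w. \<Sum>(a, b)\<leftarrow>p # ss. a x * b w) = fscale (a x) b + (\<lambda>w. \<Sum>(a, b)\<leftarrow>ss. a x * b w)"
        by (auto simp: p fscale_def mult.commute)
      then have "(k \<otimes>\<^sub>f (\<lambda>w. \<Sum>(a, b)\<leftarrow>p # ss. a w * b y)) (\<delta> x) =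
          b y * dual_bracket \<delta> k a x + (k \<otimes>\<^sub>f (\<lambda>w. \<Sum>(a, b)\<leftarrow>ss. a w * b y)) (\<delta> x)"
        "(k \<otimes>\<^sub>f (\<lambda>w. \<Sum>(a, b)\<leftarrow>p # ss. a x * b w)) (\<delta> y) =
          a x * dual_bracket \<delta> k b y + (k \<otimes>\<^sub>f (\<lambda>w. \<Sum>(a, b)\<leftarrow>ss. a x * b w)) (\<delta> y)"
        by (simp_all add: ftensor_add_right ftensor_scale_right dual_bracket_def)
           (simp_all add: fscale_def)
      moreover have "fact_on (dual_bracket \<delta>) k (p # ss) =
          dual_bracket \<delta> k a \<otimes>\<^sub>f b + a \<otimes>\<^sub>f dual_bracket \<delta> k b + fact_on (dual_bracket \<delta>) k ss"
        by (simp add: fact_on_def p)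
      moreover have "fact_on (dual_bracket \<delta>) k ss \<in> dual \<and> fact_on (dual_bracket \<delta>) k ss (x \<otimes>\<^sub>t y) =
          (k \<otimes>\<^sub>f (\<lambda>w. \<Sum>(a, b)\<leftarrow>ss. a w * b y)) (\<delta> x) + (k \<otimes>\<^sub>f (\<lambda>w. \<Sum>(a, b)\<leftarrow>ss. a x * b w)) (\<delta> y)"
        using Cons by simp
      moreover have "dual_bracket \<delta> k a \<otimes>\<^sub>f b + a \<otimes>\<^sub>f dual_bracket \<delta> k b + g \<in> dual" if "g \<in> dual" for g
        by (intro fun_add_in_dual ftensor_in_dual that)
      ultimately show ?case
        using a b by (simp add: ftensor_tensor dual_bracket_in_dual[OF lin] algebra_simps
            del: plus_fun_apply) (simp add: ftensor_tensor dual_bracket_in_dual[OF lin])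
    qed
    from this[of rs] rs C show ?thesis
      unfolding val by (auto simp: represents_def)
  qed
  have fd: "fact_on (dual_bracket \<delta>) f qs \<in> dual" "fact_on (dual_bracket \<delta>) h ps \<in> dual"
    using fact f h ps qs by blast+
  show ?thesis
  proof (rule dual_eqI_tensor)
    fix x y
    have comp_dual: "(\<lambda>w. k (\<phi> z w)) \<in> dual" if "k \<in> dual" for k z
      using that by (simp add: dual_iff bilinear_linear[OF bil])
    \<comment> \<open>\<open>f \<otimes> h\<close> after the action of \<open>z\<close> is a sum of two pure tensors.\<close>
    have act: "(f \<otimes>\<^sub>f h) (act \<phi> z t) =
        ((\<lambda>w. f (\<phi> z w)) \<otimes>\<^sub>f h) t + (f \<otimes>\<^sub>f (\<lambda>w. h (\<phi> z w))) t" for z t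
    proof -
      have "(f \<otimes>\<^sub>f h) \<circ> act \<phi> z = (\<lambda>w. f (\<phi> z w)) \<otimes>\<^sub>f h + f \<otimes>\<^sub>f (\<lambda>w. h (\<phi> z w))"
        by (rule dual_eqI_tensor)
           (auto intro!: dual_comp fun_add_in_dual ftensor_in_dual
             simp: act_tensor[OF bil] dual_add[OF ftensor_in_dual] ftensor_tensor comp_dual f h
               linear_vscale_iff act_linear)
      then show ?thesis by (auto simp: fun_eq_iff)
    qed
    have swap: "(k \<otimes>\<^sub>f l) (\<delta> z) = - (l \<otimes>\<^sub>f k) (\<delta> z)" if "k \<in> dual" "l \<in> dual" for k l z
      using dual_bracket_skew[OF co that] by (auto simp: dual_bracket_def fun_eq_iff)
    have neg: "(k \<otimes>\<^sub>f (\<lambda>w. l (\<phi> w z))) t = - (k \<otimes>\<^sub>f (\<lambda>w. l (\<phi> z w))) t" if "l \<in> dual" for k l z t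
    proof -
      have "(\<lambda>w. l (\<phi> w z)) = fscale (-1) (\<lambda>w. l (\<phi> z w))"
        by (subst skew) (simp add: fscale_def dual_minus[OF that])
      then show ?thesis by (simp only: ftensor_scale_right) (simp add: fscale_def)
    qed
    have "dual_map \<phi> (dual_bracket \<delta> f h) (x \<otimes>\<^sub>t y) =
        (f \<otimes>\<^sub>f h) (act \<phi> x (\<delta> y)) - (f \<otimes>\<^sub>f h) (act \<phi> y (\<delta> x))"
      by (simp add: dual_map_tensor[OF bil] dual_bracket_def cocycle dual_diff[OF ftensor_in_dual])
    also have "\<dots> = (fact_on (dual_bracket \<delta>) f qs - fact_on (dual_bracket \<delta>) h ps) (x \<otimes>\<^sub>t y)"
      using fact[OF f qs, of x y] fact[OF h ps, of x y]
        swap[OF comp_dual[OF f] h] neg[OF h, of f y] neg[OF f, of h y]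
      by (simp add: act)
    finally show "dual_map \<phi> (dual_bracket \<delta> f h) (x \<otimes>\<^sub>t y) =
        (fact_on (dual_bracket \<delta>) f qs - fact_on (dual_bracket \<delta>) h ps) (x \<otimes>\<^sub>t y)" .
  qed (use fd in \<open>auto intro!: dual_map_in_dual dual_bracket_in_dual[OF lin] fun_diff_in_dual\<close>)
qed

lemma subspace_fun_tensor_square: "fs.subspace (fun_tensor_square C)"
  unfolding fun_tensor_square_def by (rule fs.subspace_span)

text \<open>
  Characteristic zero is used only for \<open>\<Delta> f = t - t \<circ> twist\<close>, with \<open>t = \<Delta> f / 2\<close>.
\<close>

theorem lie_bialgebra_on_good_subspace:
  fixes \<phi> :: "('b, 'k::field_char_0) bracket"
  assumes bialg: "lie_bialgebra \<phi> \<delta>" and good: "good_subspace \<phi> C"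
    and closed: "\<And>f h. f \<in> C \<Longrightarrow> h \<in> C \<Longrightarrow> dual_bracket \<delta> f h \<in> C"
  shows "lie_bialgebra_on C (dual_bracket \<delta>) (dual_map \<phi>)"
proof -
  have lie: "lie_algebra \<phi>" and co: "lie_coalgebra \<delta>"
    using bialg by (auto simp: lie_bialgebra_def)
  have sub: "fs.subspace C" and C: "C \<subseteq> dual"
    and sq: "\<And>f. f \<in> C \<Longrightarrow> dual_map \<phi> f \<in> fun_tensor_square C"
    using good by (auto simp: good_subspace_def)
  note bil = lie_algebra_bilinear[OF lie]
  have CD: "\<And>f. f \<in> C \<Longrightarrow> f \<in> dual" using C by auto
  have antisym: "\<exists>t\<in>fun_tensor_square C. dual_map \<phi> f = t - (t \<circ> twist)" if "f \<in> C" for f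
  proof (rule bexI)
    have f: "f \<in> dual" using that C by auto
    show "dual_map \<phi> f = fscale (1/2) (dual_map \<phi> f) - (fscale (1/2) (dual_map \<phi> f) \<circ> twist)"
    proof (rule dual_eqI_tensor)
      fix u v
      have "f (\<phi> v u) = - f (\<phi> u v)"
        using dual_minus[OF f] lie_algebra_skew[OF lie] by metis
      then show "dual_map \<phi> f (u \<otimes>\<^sub>t v) =
          (fscale (1/2) (dual_map \<phi> f) - (fscale (1/2) (dual_map \<phi> f) \<circ> twist)) (u \<otimes>\<^sub>t v)"
        by (simp add: fscale_def twist_tensor dual_map_tensor[OF bil])
    qed (use f in \<open>auto intro!: fun_diff_in_dual dual_comp linear_twist fun_scale_in_dual
        dual_map_in_dual\<close>)
    show "fscale (1/2) (dual_map \<phi> f) \<in> fun_tensor_square C"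
      using sq[OF that] subspace_fun_tensor_square fs.subspace_scale by blast
  qed
  show ?thesis
    unfolding lie_bialgebra_on_def Let_def
  proof (intro conjI ballI allI impI)
    fix f g h c
    show "dual_bracket \<delta> (fscale c f + g) h = fscale c (dual_bracket \<delta> f h) + dual_bracket \<delta> g h"
      "dual_bracket \<delta> h (fscale c f + g) = fscale c (dual_bracket \<delta> h f) + dual_bracket \<delta> h g"
      by (simp_all add: dual_bracket_def ftensor_add_left ftensor_scale_left ftensor_add_right
          ftensor_scale_right fun_eq_iff) (simp_all add: fscale_def)
    show "dual_map \<phi> (fscale c f + g) = fscale c (dual_map \<phi> f) + dual_map \<phi> g"
      by (auto simp: dual_map_def fscale_def fun_eq_iff)
  next
    fix f ps assume "f \<in> C" "represents C ps (dual_map \<phi> f)"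
    then show "(\<Sum>(y, z)\<leftarrow>ps. y \<otimes>\<^sub>f dual_map \<phi> z) + ((\<Sum>(y, z)\<leftarrow>ps. y \<otimes>\<^sub>f dual_map \<phi> z) \<circ> cyc)
        + ((\<Sum>(y, z)\<leftarrow>ps. y \<otimes>\<^sub>f dual_map \<phi> z) \<circ> cyc \<circ> cyc) = 0"
      by (intro dual_map_cojacobi[OF lie CD C _ refl])
  qed (use sub C sq antisym closed dual_bracket_self[OF co] dual_bracket_jacobi[OF co]
      dual_map_dual_bracket[OF bialg _ _ C] in \<open>auto simp: CD\<close>)
qed

section \<open>Finite-dimensional spaces of functions\<close>

text \<open>
  In contrast to linear dependence of a set, repetitions in the family \<open>F\<close> count.
\<close>

lemma dependent_family:
  assumes "finite Z" "finite I" "card Z < card I" "\<And>i. i \<in> I \<Longrightarrow> F i \<in> fs.span Z"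
  shows "\<exists>c. (\<exists>i\<in>I. c i \<noteq> 0) \<and> (\<Sum>i\<in>I. fscale (c i) (F i)) = 0"
proof (cases "inj_on F I")
  case True
  have "fs.dependent (F ` I)"
  proof (rule ccontr)
    assume "fs.independent (F ` I)"
    then have "card (F ` I) \<le> card Z"
      using fs.independent_span_bound[OF assms(1)] assms(4) by blast
    then show False using card_image[OF True] assms(3) by simp
  qed
  then obtain u where u: "\<exists>v\<in>F ` I. u v \<noteq> 0" "(\<Sum>v\<in>F ` I. fscale (u v) v) = 0"
    using fs.dependent_finite[of "F ` I"] assms(2) by auto
  then show ?thesis
    by (intro exI[of _ "u \<circ> F"]) (auto simp: sum.reindex[OF True] o_def)
next
  case False
  then obtain i j where ij: "i \<in> I" "j \<in> I" "i \<noteq> j" "F i = F j" by (auto simp: inj_on_def)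
  define c where "c k = (if k = i then 1 else if k = j then - 1 else 0 :: 'b)" for k
  have "(\<Sum>k\<in>I. fscale (c k) (F k)) = (\<Sum>k\<in>{i, j}. fscale (c k) (F k))"
    by (rule sum.mono_neutral_right) (use assms(2) ij in \<open>auto simp: c_def fscale_def fun_eq_iff\<close>)
  also have "\<dots> = 0" using ij by (auto simp: c_def fscale_def fun_eq_iff)
  finally show ?thesis using ij by (intro exI[of _ c]) (auto simp: c_def)
qed

lemma fun_sum_apply: "(\<Sum>i\<in>I. F i) x = (\<Sum>i\<in>I. F i x :: 'b::comm_monoid_add)"
  by (induction I rule: infinite_finite_induct) auto

text \<open>
  A finite-dimensional space of functions has a basis that is dual to evaluation at finitely many
  points. In the induction step, a function \<open>w0\<close> outside the smaller space is made to vanish at the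
  points found so far; it remains nonzero at some new point \<open>p\<close>.
\<close>

lemma interpolation_basis_exists:
  fixes W :: "('x \<Rightarrow> 'k::field) set"
  assumes "finite G" "fs.subspace W" "W \<subseteq> fs.span G"
  shows "\<exists>J g. finite J \<and> (\<forall>j\<in>J. g j \<in> W) \<and> (\<forall>i\<in>J. \<forall>j\<in>J. g i j = (if i = j then 1 else 0)) \<and>
           (\<forall>w\<in>W. w = (\<Sum>j\<in>J. fscale (w j) (g j)))"
  using assms
proof (induction G arbitrary: W rule: finite_induct)
  case empty
  show ?case
  proof (intro exI conjI ballI)
    show "finite ({} :: 'x set)" by simp
    show "w = (\<Sum>j\<in>{}. fscale (w j) ((\<lambda>_. 0) j))" if "w \<in> W" for w
      using that empty by auto
  qed simp_all
next
  case (insert a G)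
  show ?case
  proof (cases "W \<subseteq> fs.span G")
    case True
    with insert show ?thesis by blast
  next
    case False
    then obtain w0 where w0: "w0 \<in> W" "w0 \<notin> fs.span G" by auto
    define W1 where "W1 = W \<inter> fs.span G"
    have W1: "fs.subspace W1" "W1 \<subseteq> fs.span G"
      unfolding W1_def by (auto intro!: fs.subspace_inter insert.prems fs.subspace_span)
    obtain J g where J: "finite J" and g: "\<forall>j\<in>J. g j \<in> W1"
      "\<forall>i\<in>J. \<forall>j\<in>J. g i j = (if i = j then 1 else 0)"
      "\<forall>w\<in>W1. w = (\<Sum>j\<in>J. fscale (w j) (g j))"
      using insert.IH[OF W1] by (elim exE conjE)
    note gW1 = g(1)[rule_format] and g\<delta> = g(2)[rule_format] and rep = g(3)[rule_format]
    have gW: "g j \<in> W" "g j \<in> fs.span G" if "j \<in> J" for j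
      using gW1[OF that] by (auto simp: W1_def)
    define v where "v = w0 - (\<Sum>j\<in>J. fscale (w0 j) (g j))"
    have vW: "v \<in> W"
      unfolding v_def using insert.prems(1) w0 gW
      by (intro fs.subspace_diff fs.subspace_sum fs.subspace_scale) auto
    have "v \<noteq> 0"
    proof
      assume "v = 0"
      then have "w0 = (\<Sum>j\<in>J. fscale (w0 j) (g j))" by (simp add: v_def)
      also have "\<dots> \<in> fs.span G" using gW by (intro fs.span_sum fs.span_scale) auto
      finally show False using w0 by simp
    qed
    then obtain p where p: "v p \<noteq> 0" by (auto simp: fun_eq_iff)
    have vJ: "v i = 0" if "i \<in> J" for i
    proof -
      have "(\<Sum>j\<in>J. w0 j * g j i) = (\<Sum>j\<in>J. if j = i then w0 j else 0)"
        by (rule sum.cong) (use g\<delta> that in auto)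
      then show ?thesis using that J by (simp add: v_def fun_sum_apply fscale_def)
    qed
    then have pJ: "p \<notin> J" using p by auto
    define h where "h = fscale (1 / v p) v"
    define g' where "g' j = (if j = p then h else g j - fscale (g j p) h)" for j
    have hW: "h \<in> W" unfolding h_def using vW insert.prems(1) by (simp add: fs.subspace_scale)
    have h: "h p = 1" "\<And>i. i \<in> J \<Longrightarrow> h i = 0" using p vJ by (auto simp: h_def fscale_def)
    \<comment> \<open>Modulo a multiple \<open>\<alpha> w0\<close>, every \<open>w\<close> lies in \<open>W1\<close>, where \<open>g\<close> interpolates.\<close>
    have rep': "w = (\<Sum>j\<in>insert p J. fscale (w j) (g' j))" if wW: "w \<in> W" for w
    proof -
      obtain k where k: "w - fscale k a \<in> fs.span G"
        using subsetD[OF insert.prems(2) wW] unfolding fs.span_breakdown_eq by blast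
      obtain k0 where k0: "w0 - fscale k0 a \<in> fs.span G"
        using subsetD[OF insert.prems(2) w0(1)] unfolding fs.span_breakdown_eq by blast
      have "k0 \<noteq> 0" using k0 w0 by (auto simp: fscale_def simp flip: zero_fun_def)
      define \<alpha> where "\<alpha> = k / k0"
      define w1 where "w1 = w - fscale \<alpha> w0"
      have "w1 = (w - fscale k a) - fscale \<alpha> (w0 - fscale k0 a)"
        using \<open>k0 \<noteq> 0\<close> by (auto simp: w1_def \<alpha>_def fscale_def fun_eq_iff field_simps)
      then have "w1 \<in> fs.span G" using k k0 by (simp add: fs.span_diff fs.span_scale)
      moreover have "w1 \<in> W"
        unfolding w1_def using wW w0 insert.prems(1) by (intro fs.subspace_diff fs.subspace_scale)
      ultimately have w1: "w1 = (\<Sum>j\<in>J. fscale (w1 j) (g j))" by (intro rep) (simp add: W1_def)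
      have split: "w x = \<alpha> * v x + (\<Sum>j\<in>J. w j * g j x)" for x
      proof -
        have "w x = \<alpha> * w0 x + w1 x" by (simp add: w1_def fscale_def)
        also have "w1 x = (\<Sum>j\<in>J. w1 j * g j x)"
          using fun_cong[OF w1, of x] by (simp add: fun_sum_apply fscale_def)
        also have "\<dots> = (\<Sum>j\<in>J. w j * g j x) - \<alpha> * (\<Sum>j\<in>J. w0 j * g j x)"
          by (simp add: w1_def fscale_def sum_subtractf sum_distrib_left algebra_simps)
        also have "(\<Sum>j\<in>J. w0 j * g j x) = w0 x - v x"
          by (simp add: v_def fun_sum_apply fscale_def)
        finally show ?thesis by (simp add: algebra_simps)
      qed
      show ?thesis
      proof
        fix x
        have "(\<Sum>j\<in>insert p J. fscale (w j) (g' j)) x =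
            w p * h x + (\<Sum>j\<in>J. w j * (g j x - g j p * h x))"
        proof -
          have "(\<Sum>j\<in>J. w j * g' j x) = (\<Sum>j\<in>J. w j * (g j x - g j p * h x))"
            by (rule sum.cong) (use pJ in \<open>auto simp: g'_def fscale_def\<close>)
          then show ?thesis using J pJ by (simp add: fun_sum_apply fscale_def g'_def)
        qed
        also have "\<dots> = (\<Sum>j\<in>J. w j * g j x) + (w p - (\<Sum>j\<in>J. w j * g j p)) * h x"
          by (simp add: algebra_simps sum_subtractf sum_distrib_left sum_distrib_right)
        also have "w p - (\<Sum>j\<in>J. w j * g j p) = \<alpha> * v p" using split[of p] by simp
        also have "(\<Sum>j\<in>J. w j * g j x) + \<alpha> * v p * h x = w x"
          using split[of x] p by (simp add: h_def fscale_def)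
        finally show "w x = (\<Sum>j\<in>insert p J. fscale (w j) (g' j)) x" by simp
      qed
    qed
    have g'W: "g' j \<in> W" if "j \<in> insert p J" for j
      using that hW gW insert.prems(1) pJ
      by (auto simp: g'_def intro!: fs.subspace_diff fs.subspace_scale)
    have g'\<delta>: "g' i j = (if i = j then 1 else 0)" if "i \<in> insert p J" "j \<in> insert p J" for i j
      using that h g\<delta> pJ by (auto simp: g'_def fscale_def)
    show ?thesis
    proof (intro exI conjI ballI)
      show "finite (insert p J)" using J by simp
      show "g' j \<in> W" if "j \<in> insert p J" for j by (rule g'W[OF that])
      show "g' i j = (if i = j then 1 else 0)" if "i \<in> insert p J" "j \<in> insert p J" for i j
        by (rule g'\<delta>[OF that])
      show "w = (\<Sum>j\<in>insert p J. fscale (w j) (g' j))" if "w \<in> W" for w by (rule rep'[OF that])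
    qed
  qed
qed

lemma interpolation_basis:
  fixes W :: "('x \<Rightarrow> 'k::field) set"
  assumes "finite G" "fs.subspace W" "W \<subseteq> fs.span G"
  obtains J g where "finite J" "\<And>j. j \<in> J \<Longrightarrow> g j \<in> W"
    "\<And>w. w \<in> W \<Longrightarrow> w = (\<Sum>j\<in>J. fscale (w j) (g j))"
proof -
  obtain J g where *: "finite J" "\<forall>j\<in>J. g j \<in> W"
    "\<forall>w\<in>W. w = (\<Sum>j\<in>J. fscale (w j) (g j))"
    using interpolation_basis_exists[OF assms] by (elim exE conjE)
  show ?thesis
    by (rule that[OF *(1)], rule *(2)[rule_format], assumption, rule *(3)[rule_format], assumption)
qed

section \<open>Good subspaces and forms of finite rank\<close>

lemma fun_tensor_square_finite_rank:
  assumes "t \<in> fun_tensor_square U" "U \<subseteq> dual"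
  shows "\<exists>Z. finite Z \<and> (\<forall>u. (\<lambda>v. t (u \<otimes>\<^sub>t v)) \<in> fs.span Z)"
  using assms(1) unfolding fun_tensor_square_def
proof (induction rule: fs.span_induct_alt)
  case base
  show ?case by (intro exI[of _ "{}"]) (auto simp flip: zero_fun_def)
next
  case (step c x y)
  then obtain Z where Z: "finite Z" "\<And>u. (\<lambda>v. y (u \<otimes>\<^sub>t v)) \<in> fs.span Z" by auto
  obtain f h where x: "x = f \<otimes>\<^sub>f h" "f \<in> dual" "h \<in> dual" using step assms(2) by auto
  have "(\<lambda>v. (fscale c x + y) (u \<otimes>\<^sub>t v)) = fscale (c * f u) h + (\<lambda>v. y (u \<otimes>\<^sub>t v))" for u
    by (auto simp: x ftensor_tensor fscale_def)
  moreover have "fscale (c * f u) h + (\<lambda>v. y (u \<otimes>\<^sub>t v)) \<in> fs.span (insert h Z)" for u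
    using Z(2)[of u] fs.span_mono[of Z "insert h Z"]
    by (intro fs.span_add fs.span_scale) (auto intro: fs.span_base)
  ultimately show ?case using Z(1) by (intro exI[of _ "insert h Z"]) auto
qed

lemma good_subspace_finite_rank:
  assumes "good_subspace \<phi> U" "\<phi> \<in> bilinear_maps vscale" "f \<in> U"
  obtains Z where "finite Z" "\<And>u. (\<lambda>v. f (\<phi> u v)) \<in> fs.span Z"
proof -
  have "dual_map \<phi> f \<in> fun_tensor_square U" "U \<subseteq> dual"
    using assms(1,3) by (auto simp: good_subspace_def)
  from fun_tensor_square_finite_rank[OF this] show ?thesis
    using that by (auto simp: dual_map_tensor[OF assms(2)])
qed

lemma coadjoint_in_subspace:
  fixes \<phi> :: "('b, 'k::field) bracket"
  assumes "\<phi> \<in> bilinear_maps vscale" "f \<in> dual" "fs.subspace C"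
    and "\<And>b. (\<lambda>v. f (\<phi> (basis b) v)) \<in> C"
  shows "(\<lambda>v. f (\<phi> u v)) \<in> C"
proof -
  have "(\<lambda>w. f (\<phi> w v)) \<in> dual" for v
    using assms(2) by (simp add: dual_iff bilinear_linear[OF assms(1)])
  then have "f (\<phi> u v) =
      (\<Sum>b\<in>Poly_Mapping.keys u. Poly_Mapping.lookup u b * f (\<phi> (basis b) v))" for v
    by (rule dual_expand)
  then have "(\<lambda>v. f (\<phi> u v)) =
      (\<Sum>b\<in>Poly_Mapping.keys u. fscale (Poly_Mapping.lookup u b) (\<lambda>v. f (\<phi> (basis b) v)))"
    by (auto simp: fun_eq_iff fun_sum_apply fscale_def)
  also have "\<dots> \<in> C" using assms(3,4) by (intro fs.subspace_sum fs.subspace_scale) auto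
  finally show ?thesis .
qed

text \<open>
  Interpolation in the space of all \<open>f \<circ> [u, -]\<close> at points \<open>j\<close> gives
  \<open>f [u, v] = \<Sum>j. f [u, j] * g j v\<close>, where both factors are coadjoint translates of \<open>f\<close>.
\<close>

lemma good_subspaceI:
  assumes lie: "lie_algebra \<phi>" and sub: "fs.subspace C" and C: "C \<subseteq> dual"
    and coad: "\<And>f u. f \<in> C \<Longrightarrow> (\<lambda>v. f (\<phi> u v)) \<in> C"
    and fin: "\<And>f. f \<in> C \<Longrightarrow> \<exists>G. finite G \<and> (\<forall>u. (\<lambda>v. f (\<phi> u v)) \<in> fs.span G)"
  shows "good_subspace \<phi> C"
proof -
  note bil = lie_algebra_bilinear[OF lie]
  have "dual_map \<phi> f \<in> fun_tensor_square C" if f: "f \<in> C" for f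
  proof -
    have fd: "f \<in> dual" using f C by auto
    define W where "W = range (\<lambda>u v. f (\<phi> u v))"
    obtain G where G: "finite G" "\<And>u. (\<lambda>v. f (\<phi> u v)) \<in> fs.span G" using fin[OF f] by auto
    have Wsub: "fs.subspace W"
    proof (rule fs.subspaceI)
      have "0 = (\<lambda>v. f (\<phi> 0 v))" by (auto simp: bilinear_linear[OF bil] dual_zero[OF fd])
      then show "0 \<in> W" unfolding W_def by (rule range_eqI)
      fix x y c assume "x \<in> W" "y \<in> W"
      then obtain u u' where u: "x = (\<lambda>v. f (\<phi> u v))" "y = (\<lambda>v. f (\<phi> u' v))"
        by (auto simp: W_def)
      have "x + y = (\<lambda>v. f (\<phi> (u + u') v))"
        by (auto simp: u bilinear_linear[OF bil] dual_add[OF fd])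
      then show "x + y \<in> W" unfolding W_def by (rule range_eqI)
      have "fscale c x = (\<lambda>v. f (\<phi> (vscale c u) v))"
        by (auto simp: u fscale_def bilinear_linear[OF bil] dual_scale[OF fd])
      then show "fscale c x \<in> W" unfolding W_def by (rule range_eqI)
    qed
    have Wspan: "W \<subseteq> fs.span G" using G by (auto simp: W_def)
    obtain J g where J: "finite J" "\<And>j. j \<in> J \<Longrightarrow> g j \<in> W"
      and rep: "\<And>w. w \<in> W \<Longrightarrow> w = (\<Sum>j\<in>J. fscale (w j) (g j))"
      by (rule interpolation_basis[OF G(1) Wsub Wspan]) (rule that)
    have gC: "g j \<in> C" if "j \<in> J" for j using J(2)[OF that] coad[OF f] by (auto simp: W_def)
    have lC: "(\<lambda>u. f (\<phi> u j)) \<in> C" for j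
    proof -
      have "(\<lambda>u. f (\<phi> u j)) = fscale (- 1) (\<lambda>u. f (\<phi> j u))"
      proof
        fix u
        show "f (\<phi> u j) = fscale (- 1) (\<lambda>u. f (\<phi> j u)) u"
          using dual_minus[OF fd, of "\<phi> j u"] lie_algebra_skew[OF lie, of u j]
          by (simp add: fscale_def)
      qed
      then show ?thesis using coad[OF f] sub by (simp only: fs.subspace_scale)
    qed
    have "dual_map \<phi> f = (\<Sum>j\<in>J. (\<lambda>u. f (\<phi> u j)) \<otimes>\<^sub>f g j)"
    proof (rule dual_eqI_tensor)
      fix u v
      have "f (\<phi> u v) = (\<Sum>j\<in>J. f (\<phi> u j) * g j v)"
        using fun_cong[OF rep[of "\<lambda>v. f (\<phi> u v)"], of v]
        by (auto simp: W_def fun_sum_apply fscale_def)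
      also have "\<dots> = (\<Sum>j\<in>J. ((\<lambda>u. f (\<phi> u j)) \<otimes>\<^sub>f g j) (u \<otimes>\<^sub>t v))"
        by (rule sum.cong) (use lC gC C in \<open>auto simp: ftensor_tensor subset_iff\<close>)
      finally show "dual_map \<phi> f (u \<otimes>\<^sub>t v) = (\<Sum>j\<in>J. (\<lambda>u. f (\<phi> u j)) \<otimes>\<^sub>f g j) (u \<otimes>\<^sub>t v)"
        by (simp add: fun_sum_apply dual_map_tensor[OF bil])
    qed (auto intro!: dual_map_in_dual fd fs.subspace_sum[OF subspace_dual] ftensor_in_dual)
    also have "\<dots> \<in> fun_tensor_square C"
      unfolding fun_tensor_square_def
      by (rule fs.span_sum, rule fs.span_base) (use lC gC in blast)
    finally show ?thesis .
  qed
  then show ?thesis using sub C by (auto simp: good_subspace_def)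
qed

section \<open>Linear recurrences\<close>

text \<open>The sequence \<open>a\<close> read from position \<open>i\<close> on.\<close>

definition shift :: "int \<Rightarrow> (int \<Rightarrow> 'k) \<Rightarrow> int \<Rightarrow> 'k" where
  "shift i a j = a (i + j)"

text \<open>The shifts of \<open>a\<close> span a finite-dimensional space.\<close>

definition shift_finite :: "(int \<Rightarrow> 'k::field) \<Rightarrow> bool" where
  "shift_finite a \<longleftrightarrow> (\<exists>G. finite G \<and> (\<forall>i. shift i a \<in> fs.span G))"

text \<open>
  Linear recurrence with constant coefficients. As in \<open>Acirc\<close>, the last coefficient \<open>c r\<close> may be zero;
  then the recurrence cannot be solved for \<open>a (n - r)\<close>.
\<close>

definition recurrent :: "(int \<Rightarrow> 'k::field) \<Rightarrow> bool" where
  "recurrent a \<longleftrightarrow> (\<exists>(r::nat) c. \<forall>n. a n = (\<Sum>j=1..r. c j * a (n - int j)))"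

text \<open>
  A nontrivial linear relation between shifts is a recurrence if the largest shift \<open>d p0\<close> occurs in
  a single term with nonzero coefficient: solve for that term. Other shifts may occur several times.
\<close>

lemma recurrentI:
  assumes "finite P" "p0 \<in> P" "w p0 \<noteq> 0" "\<And>p. p \<in> P \<Longrightarrow> p \<noteq> p0 \<Longrightarrow> d p < d p0"
    and ann: "\<And>n. (\<Sum>p\<in>P. w p * a (d p + n)) = 0"
  shows "recurrent a"
proof -
  define Q where "Q = P - {p0}"
  define g where "g p = nat (d p0 - d p)" for p
  define r where "r = (\<Sum>p\<in>Q. g p)"
  define c where "c j = - (\<Sum>p | p \<in> Q \<and> g p = j. w p / w p0)" for j
  have Q: "finite Q" using assms(1) by (simp add: Q_def)
  have gQ: "g ` Q \<subseteq> {1..r}"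
  proof safe
    fix p assume p: "p \<in> Q"
    then have "d p < d p0" using assms(4) by (auto simp: Q_def)
    then show "g p \<in> {1..r}"
      using member_le_sum[of p Q g] p Q by (auto simp: g_def r_def)
  qed
  have "a n = (\<Sum>j=1..r. c j * a (n - int j))" for n
  proof -
    have "(\<Sum>j=1..r. c j * a (n - int j)) =
        - (\<Sum>j=1..r. \<Sum>p | p \<in> Q \<and> g p = j. w p / w p0 * a (n - int (g p)))"
      by (simp add: c_def sum_distrib_right sum_negf)
    also have "\<dots> = - (\<Sum>p\<in>Q. w p / w p0 * a (n - int (g p)))"
      using sum.group[OF Q _ gQ, of "\<lambda>p. w p / w p0 * a (n - int (g p))"] by simp
    also have "(\<Sum>p\<in>Q. w p / w p0 * a (n - int (g p))) = (\<Sum>p\<in>Q. w p * a (d p + (n - d p0))) / w p0"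
      unfolding sum_divide_distrib
    proof (rule sum.cong)
      fix p assume "p \<in> Q"
      then have "d p < d p0" using assms(4) by (auto simp: Q_def)
      then have "n - int (g p) = d p + (n - d p0)" by (simp add: g_def)
      then show "w p / w p0 * a (n - int (g p)) = w p * a (d p + (n - d p0)) / w p0"
        by (metis times_divide_eq_left)
    qed simp
    also have "(\<Sum>p\<in>Q. w p * a (d p + (n - d p0))) = - (w p0 * a n)"
      using ann[of "n - d p0"] assms(1,2) by (simp add: Q_def sum.remove[of P p0] eq_neg_iff_add_eq_0 add.commute)
    finally show ?thesis using assms(3) by simp
  qed
  then show ?thesis unfolding recurrent_def by blast
qed

lemma recurrentI_int:
  assumes "finite I" "\<exists>i\<in>I. w i \<noteq> 0" "\<And>n. (\<Sum>i\<in>I. w i * a (i + n)) = 0"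
  shows "recurrent a"
proof -
  define P where "P = {i \<in> I. w i \<noteq> 0}"
  have P: "finite P" "P \<noteq> {}" using assms by (auto simp: P_def)
  have "(\<Sum>i\<in>P. w i * a (i + n)) = (\<Sum>i\<in>I. w i * a (i + n))" for n
    by (rule sum.mono_neutral_left) (use assms(1) in \<open>auto simp: P_def\<close>)
  then have "(\<Sum>i\<in>P. w i * a (i + n)) = 0" for n by (simp add: assms(3))
  then show ?thesis
    using Max_in[OF P] Max_ge[OF P(1)]
    by (intro recurrentI[of P "Max P" w "\<lambda>i. i"]) (use P(1) in \<open>auto simp: P_def less_le\<close>)
qed

lemma shift_finite_imp_recurrent:
  assumes "shift_finite a"
  shows "recurrent a"
proof -
  obtain G where G: "finite G" "\<And>i. shift i a \<in> fs.span G"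
    using assms by (auto simp: shift_finite_def)
  obtain c where c: "\<exists>i\<in>{0..int (card G)}. c i \<noteq> 0"
    "(\<Sum>i\<in>{0..int (card G)}. fscale (c i) (shift i a)) = 0"
    using dependent_family[OF G(1), of "{0..int (card G)}" "\<lambda>i. shift i a"] G(2)
    by (elim meta_impE exE conjE) auto
  show ?thesis
  proof (rule recurrentI_int[OF _ c(1)])
    show "(\<Sum>i\<in>{0..int (card G)}. c i * a (i + n)) = 0" for n
      using fun_cong[OF c(2), of n] by (simp add: fun_sum_apply fscale_def shift_def)
  qed simp
qed

text \<open>
  For minimal order \<open>r\<close> the last coefficient is nonzero, so that the recurrence can also be solved
  backwards. Hence the span \<open>W n\<close> of any \<open>r\<close> consecutive shifts does not depend on \<open>n\<close>.
\<close>

lemma recurrent_imp_shift_finite: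
  assumes "recurrent a"
  shows "shift_finite a"
proof -
  define R where "R r \<longleftrightarrow> (\<exists>c. \<forall>n. a n = (\<Sum>j=1..r. c j * a (n - int j)))" for r :: nat
  define r where "r = (LEAST r. R r)"
  have "\<exists>r. R r" using assms by (auto simp: recurrent_def R_def)
  then have "R r" unfolding r_def by (rule LeastI_ex)
  then obtain c where c: "\<And>n. a n = (\<Sum>j=1..r. c j * a (n - int j))" by (auto simp: R_def)
  have minimal: "\<not> R s" if "s < r" for s using that not_less_Least unfolding r_def by blast
  define W where "W n = fs.span ((\<lambda>s. shift (n - int s) a) ` {1..r})" for n
  have base: "shift (n - int s) a \<in> W n" if "1 \<le> s" "s \<le> r" for n s
    unfolding W_def using that by (intro fs.span_base) auto
  have rec: "shift n a = (\<Sum>j=1..r. fscale (c j) (shift (n - int j) a))" for n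
  proof
    fix k
    show "shift n a k = (\<Sum>j=1..r. fscale (c j) (shift (n - int j) a)) k"
      using c[of "n + k"] by (simp add: shift_def fun_sum_apply fscale_def algebra_simps)
  qed
  have top: "shift n a \<in> W n" for n
  proof -
    have "(\<Sum>j=1..r. fscale (c j) (shift (n - int j) a)) \<in> W n"
      unfolding W_def by (intro fs.span_sum fs.span_scale base[unfolded W_def]) auto
    then show ?thesis by (subst rec)
  qed
  show ?thesis
  proof (cases "r = 0")
    case True
    then show ?thesis
      using top by (auto simp: shift_finite_def W_def intro!: exI[of _ "{}"])
  next
    case False
    have cr: "c r \<noteq> 0"
    proof
      assume "c r = 0"
      then have "a n = (\<Sum>j=1..r - 1. c j * a (n - int j))" for n
        using c[of n] False by (cases r) auto
      then have "R (r - 1)" unfolding R_def by blast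
      then show False using minimal[of "r - 1"] False by simp
    qed
    have up: "W (n + 1) \<subseteq> W n" for n
    proof -
      have "shift (n + 1 - int s) a \<in> W n" if "1 \<le> s" "s \<le> r" for s
        using top[of n] base[of "s - 1" n] that by (cases "s = 1") (auto simp: algebra_simps)
      then show ?thesis
        unfolding W_def[of "n + 1"] by (intro fs.span_minimal) (auto simp: W_def)
    qed
    have bottom: "shift (n - int r) a \<in> W (n + 1)" for n
    proof -
      have W1: "shift (n - int j) a \<in> W (n + 1)" if "j < r" for j
        using base[of "j + 1" "n + 1"] that by simp
      have n0: "shift n a \<in> W (n + 1)" using W1[of 0] False by simp
      have "shift n a = (\<Sum>j=1..r - 1. fscale (c j) (shift (n - int j) a)) + fscale (c r) (shift (n - int r) a)"
        using rec[of n] False by (cases r) auto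
      then have "shift (n - int r) a = fscale (1 / c r)
          (shift n a - (\<Sum>j=1..r - 1. fscale (c j) (shift (n - int j) a)))"
        using cr by (auto simp: fscale_def fun_eq_iff field_simps)
      also have "\<dots> \<in> W (n + 1)"
        unfolding W_def
        by (intro fs.span_scale fs.span_diff fs.span_sum W1[unfolded W_def]
            n0[unfolded W_def])
           auto
      finally show ?thesis .
    qed
    have down: "W n \<subseteq> W (n + 1)" for n
    proof -
      have "shift (n - int s) a \<in> W (n + 1)" if "1 \<le> s" "s \<le> r" for s
        using bottom[of n] base[of "s + 1" "n + 1"] that by (cases "s = r") (auto simp: algebra_simps)
      then show ?thesis
        unfolding W_def[of n] by (intro fs.span_minimal) (auto simp: W_def)
    qed
    have "W n = W 0" for n
    proof (induction n rule: int_induct[where k = 0])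
      case (step1 i)
      then show ?case using up[of i] down[of i] by auto
    next
      case (step2 i)
      then show ?case using up[of "i - 1"] down[of "i - 1"] by auto
    qed simp
    then have "\<forall>n. shift n a \<in> W 0" using top by metis
    then show ?thesis
      unfolding shift_finite_def by (intro exI[of _ "(\<lambda>s. shift (0 - int s) a) ` {1..r}"]) (auto simp: W_def)
  qed
qed

lemma recurrent_iff_shift_finite: "recurrent a \<longleftrightarrow> shift_finite a"
  using recurrent_imp_shift_finite shift_finite_imp_recurrent by blast

lemma recurrentE:
  assumes "recurrent a"
  obtains G where "finite G" "\<And>i. shift i a \<in> fs.span G"
  using recurrent_imp_shift_finite[OF assms] by (auto simp: shift_finite_def)

lemma recurrent_zero: "recurrent (\<lambda>n. 0)"
  by (auto simp: recurrent_def intro!: exI[of _ 0])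

lemma recurrent_add:
  assumes "recurrent a" "recurrent b"
  shows "recurrent (\<lambda>n. a n + b n)"
proof -
  obtain G H where G: "finite G" "\<And>i. shift i a \<in> fs.span G"
    and H: "finite H" "\<And>i. shift i b \<in> fs.span H"
    using assms by (metis recurrentE)
  have "shift i (\<lambda>n. a n + b n) = shift i a + shift i b" for i
    by (auto simp: shift_def)
  moreover have "shift i a + shift i b \<in> fs.span (G \<union> H)" for i
    using G(2)[of i] H(2)[of i] fs.span_mono[of G "G \<union> H"] fs.span_mono[of H "G \<union> H"]
    by (intro fs.span_add) auto
  ultimately show ?thesis
    using G(1) H(1) unfolding recurrent_iff_shift_finite shift_finite_def
    by (intro exI[of _ "G \<union> H"]) auto
qed

lemma recurrent_scale: "recurrent a \<Longrightarrow> recurrent (\<lambda>n. c * a n)"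
proof -
  assume "recurrent a"
  then obtain r :: nat and k where k: "\<And>n. a n = (\<Sum>j=1..r. k j * a (n - int j))"
    by (auto simp: recurrent_def)
  have "c * a n = (\<Sum>j=1..r. k j * (c * a (n - int j)))" for n
    by (subst k[of n]) (simp add: sum_distrib_left mult.left_commute)
  then show ?thesis unfolding recurrent_def by blast
qed

lemma recurrent_shift: "recurrent a \<Longrightarrow> recurrent (\<lambda>n. a (i + n))"
proof -
  assume "recurrent a"
  then obtain r :: nat and k where k: "\<And>n. a n = (\<Sum>j=1..r. k j * a (n - int j))"
    by (auto simp: recurrent_def)
  have "a (i + n) = (\<Sum>j=1..r. k j * a (i + (n - int j)))" for n
    by (subst k[of "i + n"]) (simp add: add_diff_eq)
  then show ?thesis unfolding recurrent_def by blast
qed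

lemma span_image_times_index:
  assumes "a \<in> fs.span G"
  shows "(\<lambda>j. of_int j * a j) \<in> fs.span ((\<lambda>a j. of_int j * a j) ` G)"
  using assms
proof (induction rule: fs.span_induct_alt)
  case base
  show ?case using fs.span_zero by (simp add: zero_fun_def)
next
  case (step c x y)
  have "(\<lambda>j. of_int j * (fscale c x + y) j) = fscale c (\<lambda>j. of_int j * x j) + (\<lambda>j. of_int j * y j)"
    by (auto simp: fscale_def algebra_simps)
  then show ?case
    using step by (auto intro!: fs.span_add fs.span_scale intro: fs.span_base)
qed

lemma recurrent_times_index:
  assumes "recurrent a"
  shows "recurrent (\<lambda>n. of_int n * a n)"
proof -
  obtain G where G: "finite G" "\<And>i. shift i a \<in> fs.span G"
    using assms by (metis recurrentE)
  define T where "T = (\<lambda>(a :: int \<Rightarrow> 'a) j. of_int j * a j)"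
  have "shift i (\<lambda>n. of_int n * a n) = fscale (of_int i) (shift i a) + T (shift i a)" for i
    by (auto simp: shift_def fscale_def T_def algebra_simps)
  moreover have "fscale (of_int i) (shift i a) + T (shift i a) \<in> fs.span (G \<union> T ` G)" for i
    using G(2)[of i] span_image_times_index[OF G(2)[of i]] fs.span_mono[of G "G \<union> T ` G"]
      fs.span_mono[of "T ` G" "G \<union> T ` G"]
    unfolding T_def by (intro fs.span_add fs.span_scale) auto
  ultimately show ?thesis
    using G(1) unfolding recurrent_iff_shift_finite shift_finite_def
    by (intro exI[of _ "G \<union> T ` G"]) auto
qed

section \<open>The Lie algebra structure\<close>

lemma ldiff_add: "ldiff (f + g) = ldiff f + ldiff g"
  and ldiff_diff: "ldiff (f - g) = ldiff f - ldiff g"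
  and ldiff_vscale: "ldiff (vscale c f) = vscale c (ldiff f)"
  by (auto intro!: poly_mapping_eqI simp: ldiff.rep_eq lookup_add lookup_minus algebra_simps)

lemma ldiff_single: "ldiff (Poly_Mapping.single n c) = Poly_Mapping.single (n - 1) (of_int n * c)"
  by (auto intro!: poly_mapping_eqI simp: ldiff.rep_eq lookup_single when_def)

lemma laurent_induct:
  fixes f :: "'k::field laurent"
  assumes "\<And>n c. P (Poly_Mapping.single n c)" "\<And>f g. P f \<Longrightarrow> P g \<Longrightarrow> P (f + g)"
  shows "P f"
proof -
  have "P 0" using assms(1)[of 0 0] by simp
  have "P (\<Sum>n\<in>N. vscale (Poly_Mapping.lookup f n) (basis n))" if "finite N" for N
    using that
  proof (induction N rule: finite_induct)
    case (insert n N)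
    have "vscale (Poly_Mapping.lookup f n) (basis n) = Poly_Mapping.single n (Poly_Mapping.lookup f n)"
      using vscale_X[of _ n] by (simp add: basis_def X_def)
    with insert assms show ?case by simp
  qed (simp add: \<open>P 0\<close>)
  then show ?thesis by (subst poly_mapping_expand) simp
qed

lemma ldiff_mult: "ldiff (f * g) = f * ldiff g + g * ldiff (f :: 'k::field laurent)"
proof (induction f rule: laurent_induct)
  case (1 m c)
  show ?case
  proof (induction g rule: laurent_induct)
    case (1 n d)
    show ?case
      by (simp add: mult_single ldiff_single algebra_simps flip: single_add)
  qed (simp add: ldiff_add algebra_simps)
qed (simp add: ldiff_add algebra_simps)

lemma vscale_conv_mult: "vscale c f = Poly_Mapping.single 0 c * (f :: 'k::field laurent)"
  by (simp add: vscale_def mult_map_scale_conv_mult)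

lemma vscale_mult_left: "vscale c f * g = vscale c (f * (g :: 'k::field laurent))"
  and vscale_mult_right: "g * vscale c f = vscale c (g * (f :: 'k::field laurent))"
  by (simp_all add: vscale_conv_mult algebra_simps)

lemma hv1_linear: "hv1 (u + v) = hv1 u + hv1 v" "hv1 (vscale c u) = vscale c (hv1 u)"
  and hv2_linear: "hv2 (u + v) = hv2 u + hv2 v" "hv2 (vscale c u) = vscale c (hv2 u)"
  by (auto intro!: poly_mapping_eqI simp: hv1_def hv2_def map_key.rep_eq lookup_add)

lemma hv_add: "hv f g + hv f' g' = hv (f + f') (g + g')"
  and hv_zero: "hv 0 0 = 0"
  by (auto intro!: poly_mapping_eqI simp: hv.rep_eq lookup_add split: sum.splits)

lemma lie_algebra_hv: "lie_algebra (hv_bracket :: 'k::field hv \<Rightarrow> _)"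
proof -
  have "(hv_bracket :: 'k hv \<Rightarrow> _) \<in> bilinear_maps vscale"
    unfolding bilinear_maps_vscale_iff hv_bracket_def
    by (simp add: hv1_linear hv2_linear ldiff_add ldiff_vscale hv_add vscale_hv
        vscale_mult_left vscale_mult_right vs.scale_right_diff_distrib algebra_simps)
  moreover have "hv_bracket u u = 0" for u :: "'k hv"
    by (simp add: hv_bracket_def hv_zero)
  moreover have "hv_bracket x (hv_bracket y z) + hv_bracket y (hv_bracket z x) +
      hv_bracket z (hv_bracket x y) = 0" for x y z :: "'k hv"
    unfolding hv_bracket_def
    by (simp add: ldiff_diff ldiff_mult hv_add algebra_simps hv_zero)
  ultimately show ?thesis by (simp add: lie_algebra_def)
qed

lemmas bilinear_hv = lie_algebra_bilinear[OF lie_algebra_hv]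

lemma hv_X_zero: "hv (X i) 0 = basis (Inl i)"
  and hv_zero_X: "hv 0 (X i) = basis (Inr i)"
  by (auto intro!: poly_mapping_eqI simp: hv.rep_eq X_def basis_def lookup_single when_def
      split: sum.splits)

lemma hv_bracket_Inl_Inl:
  "hv_bracket (basis (Inl i)) (basis (Inl j)) = vscale (of_int (j - i)) (basis (Inl (i + j - 1)))"
  using hv_bracket_basis(1)[of "i - 1" "j - 1"] by (simp add: hv_X_zero algebra_simps)

lemma hv_bracket_Inl_Inr:
  "hv_bracket (basis (Inl i)) (basis (Inr j)) = vscale (of_int j) (basis (Inr (i + j - 1)))"
  using hv_bracket_basis(2)[of "i - 1" j] by (simp add: hv_X_zero hv_zero_X algebra_simps)

lemma hv_bracket_Inr_Inl:
  "hv_bracket (basis (Inr i)) (basis (Inl j)) = - vscale (of_int i) (basis (Inr (i + j - 1)))"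
  using lie_algebra_skew[OF lie_algebra_hv, of "basis (Inr i)" "basis (Inl j)"]
  by (simp add: hv_bracket_Inl_Inr add.commute)

lemma hv_bracket_Inr_Inr: "hv_bracket (basis (Inr i)) (basis (Inr j)) = 0"
  using hv_bracket_basis(3)[of i j] by (simp add: hv_zero_X)

lemmas hv_bracket_simps = hv_bracket_Inl_Inl hv_bracket_Inl_Inr hv_bracket_Inr_Inl hv_bracket_Inr_Inr

section \<open>The maximal good subspace\<close>

lemma Acirc_iff: "a \<in> Acirc \<longleftrightarrow> a \<in> dual \<and> recurrent (\<lambda>n. a (X n))"
  by (auto simp: Acirc_def recurrent_def)

lemma Acirc_sum_iff:
  "f \<in> Acirc_sum \<longleftrightarrow> f \<in> dual \<and> recurrent (\<lambda>n. f (basis (Inl n))) \<and> recurrent (\<lambda>n. f (basis (Inr n)))"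
proof
  assume "f \<in> Acirc_sum"
  then obtain a b where f: "f = dpair a b" and a: "a \<in> Acirc" and b: "b \<in> Acirc"
    by (auto simp: Acirc_sum_def)
  have ab: "a \<in> dual" "b \<in> dual" using a b by (auto simp: Acirc_iff)
  have "f \<in> dual"
    using ab by (simp add: f dual_iff dpair_def hv1_linear hv2_linear algebra_simps)
  moreover have "f (basis (Inl n)) = a (X n)" "f (basis (Inr n)) = b (X n)" for n
    using dual_zero[OF ab(1)] dual_zero[OF ab(2)]
    by (auto simp: f dpair_def simp flip: hv_X_zero hv_zero_X)
  ultimately show "f \<in> dual \<and> recurrent (\<lambda>n. f (basis (Inl n))) \<and> recurrent (\<lambda>n. f (basis (Inr n)))"
    using a b by (simp add: Acirc_iff)
next
  assume f: "f \<in> dual \<and> recurrent (\<lambda>n. f (basis (Inl n))) \<and> recurrent (\<lambda>n. f (basis (Inr n)))"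
  define a b where "a g = f (hv g 0)" and "b g = f (hv 0 g)" for g
  have hv_lin: "hv (g + g') 0 = hv g 0 + hv g' 0" "hv 0 (g + g') = hv 0 g + hv 0 g'"
    "hv (vscale c g) 0 = vscale c (hv g 0)" "hv 0 (vscale c g) = vscale c (hv 0 g)"
    for g g' :: "'a laurent" and c
    by (simp_all add: hv_add vscale_hv)
  have "a \<in> Acirc" "b \<in> Acirc"
    using f by (auto simp: Acirc_iff a_def b_def hv_X_zero hv_zero_X dual_iff hv_lin)
  moreover have "f = dpair a b"
  proof
    fix u
    have "f u = f (hv (hv1 u) 0 + hv 0 (hv2 u))" by (simp add: hv_add hv_surjective)
    also have "\<dots> = dpair a b u" using f by (simp add: dual_add dpair_def a_def b_def)
    finally show "f u = dpair a b u" .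
  qed
  ultimately show "f \<in> Acirc_sum" by (auto simp: Acirc_sum_def)
qed

lemma subspace_Acirc_sum: "fs.subspace Acirc_sum"
  by (rule fs.subspaceI)
     (auto simp: Acirc_sum_iff zero_in_dual recurrent_zero recurrent_add recurrent_scale
       intro: fun_add_in_dual fun_scale_in_dual, auto simp: fscale_def recurrent_scale)

lemma Acirc_sum_subset_dual: "Acirc_sum \<subseteq> dual"
  by (auto simp: Acirc_sum_iff)

text \<open>
  The coefficients \<open>c\<close> on \<open>P\<close> and \<open>e\<close> on \<open>Q\<close> are those of the two Laurent polynomials whose Wronskian
  annihilates the first component of \<open>f\<close>. Taking the exponents from disjoint ranges makes their
  degrees different, so that the leading coefficient of the Wronskian is nonzero.
\<close>

lemma hv_finite_rank_recurrent_Inl: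
  fixes f :: "'k::field_char_0 hv \<Rightarrow> 'k"
  assumes f: "f \<in> dual" and Z: "finite Z" "\<And>u. (\<lambda>v. f (hv_bracket u v)) \<in> fs.span Z"
  shows "recurrent (\<lambda>n. f (basis (Inl n)))"
proof -
  define a where "a n = f (basis (Inl n))" for n
  define N where "N = int (card Z)"
  have relation: "\<exists>c P. finite P \<and> P \<noteq> {} \<and> P \<subseteq> I \<and> (\<forall>i\<in>P. c i \<noteq> 0) \<and>
      (\<forall>j. (\<Sum>i\<in>P. c i * of_int (j - i) * a (i + j - 1)) = 0)"
    if I: "finite I" "card Z < card I" for I
  proof -
    obtain c where c: "\<exists>i\<in>I. c i \<noteq> 0"
      "(\<Sum>i\<in>I. fscale (c i) (\<lambda>v. f (hv_bracket (basis (Inl i)) v))) = 0"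
      using dependent_family[OF Z(1) I, of "\<lambda>i v. f (hv_bracket (basis (Inl i)) v)"] Z(2) by blast
    define P where "P = {i \<in> I. c i \<noteq> 0}"
    have "(\<Sum>i\<in>P. c i * of_int (j - i) * a (i + j - 1)) = 0" for j
    proof -
      have "(\<Sum>i\<in>P. c i * of_int (j - i) * a (i + j - 1)) =
          (\<Sum>i\<in>I. c i * of_int (j - i) * a (i + j - 1))"
        by (rule sum.mono_neutral_left) (use I in \<open>auto simp: P_def\<close>)
      then show ?thesis
        using fun_cong[OF c(2), of "basis (Inl j)"]
        by (simp add: fun_sum_apply fscale_def hv_bracket_simps dual_scale[OF f] a_def mult.assoc)
    qed
    then show ?thesis using I c(1) by (intro exI[of _ c] exI[of _ P]) (auto simp: P_def)
  qed
  have cards: "card Z < card {0..N}" "card Z < card {N + 1..2 * N + 1}" by (simp_all add: N_def)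
  obtain c P where P: "finite P" "P \<noteq> {}" "P \<subseteq> {0..N}" "\<And>i. i \<in> P \<Longrightarrow> c i \<noteq> 0"
    and relc: "\<And>j. (\<Sum>i\<in>P. c i * of_int (j - i) * a (i + j - 1)) = 0"
    using relation[OF finite_atLeastAtMost_int cards(1)] by blast
  obtain e Q where Q: "finite Q" "Q \<noteq> {}" "Q \<subseteq> {N + 1..2 * N + 1}" "\<And>i. i \<in> Q \<Longrightarrow> e i \<noteq> 0"
    and rele: "\<And>j. (\<Sum>i\<in>Q. e i * of_int (j - i) * a (i + j - 1)) = 0"
    using relation[OF finite_atLeastAtMost_int cards(2)] by blast
  have max: "Max P \<in> P" "Max Q \<in> Q" using P Q by auto
  have le: "i \<le> Max P" if "i \<in> P" for i using that P by auto
  have le': "k \<le> Max Q" if "k \<in> Q" for k using that Q by auto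
  define w where "w = (\<lambda>(i, k). c i * e k * of_int (k - i))"
  define d :: "int \<times> int \<Rightarrow> int" where "d = (\<lambda>(i, k). i + k - 1)"
  have ann: "(\<Sum>p\<in>P \<times> Q. w p * a (d p + n)) = 0" for n
  proof -
    define S where "S h = (\<Sum>i\<in>P. \<Sum>k\<in>Q. c i * e k * of_int (h i k) * a (i + k - 1 + n))"
      for h :: "int \<Rightarrow> int \<Rightarrow> int"
    have "S (\<lambda>i k. k + n - i) = (\<Sum>k\<in>Q. e k * (\<Sum>i\<in>P. c i * of_int (k + n - i) * a (i + (k + n) - 1)))"
      unfolding S_def by (subst sum.swap) (simp add: sum_distrib_left algebra_simps)
    then have "S (\<lambda>i k. k + n - i) = 0"
      by (simp only: relc mult_zero_right sum.neutral_const)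
    moreover have "S (\<lambda>i k. i + n - k) =
        (\<Sum>i\<in>P. c i * (\<Sum>k\<in>Q. e k * of_int (i + n - k) * a (k + (i + n) - 1)))"
      unfolding S_def by (simp add: sum_distrib_left algebra_simps)
    then have "S (\<lambda>i k. i + n - k) = 0"
      by (simp only: rele mult_zero_right sum.neutral_const)
    moreover have "S (\<lambda>i k. k + n - i) - S (\<lambda>i k. i + n - k) = 2 * S (\<lambda>i k. k - i)"
      unfolding S_def by (simp add: sum_distrib_left algebra_simps flip: sum_subtractf)
    ultimately have "S (\<lambda>i k. k - i) = 0" by simp
    then show ?thesis by (simp add: S_def w_def d_def sum.cartesian_product case_prod_unfold)
  qed
  show ?thesis
    unfolding a_def[symmetric]
  proof (rule recurrentI[OF _ _ _ _ ann, of "(Max P, Max Q)"])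
    have "Max P < Max Q" using max P(3) Q(3) by fastforce
    then show "w (Max P, Max Q) \<noteq> 0" using max P(4) Q(4) by (simp add: w_def)
    show "d p < d (Max P, Max Q)" if "p \<in> P \<times> Q" "p \<noteq> (Max P, Max Q)" for p
    proof (cases p)
      case (Pair i k)
      then show ?thesis using that le[of i] le'[of k] by (auto simp: d_def)
    qed
  qed (use P Q max in auto)
qed

lemma hv_finite_rank_recurrent_Inr:
  fixes f :: "'k::field_char_0 hv \<Rightarrow> 'k"
  assumes f: "f \<in> dual" and Z: "finite Z" "\<And>u. (\<lambda>v. f (hv_bracket u v)) \<in> fs.span Z"
  shows "recurrent (\<lambda>n. f (basis (Inr n)))"
proof -
  \<comment> \<open>The exponent 0 is left out because it contributes nothing to the derivative.\<close>
  define I where "I = {1..int (card Z) + 1}"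
  have I: "finite I" "card Z < card I" by (auto simp: I_def)
  obtain c where c: "\<exists>i\<in>I. c i \<noteq> 0"
    "(\<Sum>i\<in>I. fscale (c i) (\<lambda>v. f (hv_bracket (basis (Inr i)) v))) = 0"
    using dependent_family[OF Z(1) I, of "\<lambda>i v. f (hv_bracket (basis (Inr i)) v)"] Z(2) by blast
  show ?thesis
  proof (rule recurrentI_int[OF I(1), of "\<lambda>i. c i * of_int i"])
    show "\<exists>i\<in>I. c i * of_int i \<noteq> 0" using c(1) by (auto simp: I_def)
    show "(\<Sum>i\<in>I. c i * of_int i * f (basis (Inr (i + n)))) = 0" for n
      using fun_cong[OF c(2), of "basis (Inl (n + 1))"]
      by (simp add: fun_sum_apply fscale_def hv_bracket_simps dual_scale[OF f] dual_minus[OF f]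
          mult.assoc sum_negf)
  qed
qed

lemma good_subspace_hv_le:
  fixes U :: "('k::field_char_0 hv \<Rightarrow> 'k) set"
  assumes "good_subspace hv_bracket U"
  shows "U \<subseteq> Acirc_sum"
proof
  fix f assume f: "f \<in> U"
  then have "f \<in> dual" using assms by (auto simp: good_subspace_def)
  moreover obtain Z where "finite Z" "\<And>u. (\<lambda>v. f (hv_bracket u v)) \<in> fs.span Z"
    using good_subspace_finite_rank[OF assms bilinear_hv f] by blast
  ultimately show "f \<in> Acirc_sum"
    by (simp add: Acirc_sum_iff hv_finite_rank_recurrent_Inl hv_finite_rank_recurrent_Inr)
qed

text \<open>The functional on \<open>\<A> \<oplus> \<A>\<close> with coefficient sequences \<open>a\<close> and \<open>b\<close>.\<close>

definition hvfun :: "(int \<Rightarrow> 'k) \<Rightarrow> (int \<Rightarrow> 'k) \<Rightarrow> 'k::field hv \<Rightarrow> 'k" where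
  "hvfun a b v = (\<Sum>s\<in>Poly_Mapping.keys v. Poly_Mapping.lookup v s * case_sum a b s)"

lemma hvfun_coefficients:
  assumes "f \<in> dual"
  shows "f = hvfun (\<lambda>n. f (basis (Inl n))) (\<lambda>n. f (basis (Inr n)))"
proof
  fix v
  show "f v = hvfun (\<lambda>n. f (basis (Inl n))) (\<lambda>n. f (basis (Inr n))) v"
    by (subst dual_expand[OF assms]) (auto simp: hvfun_def intro!: sum.cong split: sum.split)
qed

lemma hvfun_add: "hvfun (a + a') (b + b') = hvfun a b + hvfun a' b'"
  and hvfun_scale: "hvfun (fscale c a) (fscale c b) = fscale c (hvfun a b)"
  by (auto simp: hvfun_def fscale_def fun_eq_iff sum_distrib_left algebra_simps
      intro!: sum.cong split: sum.split simp flip: sum.distrib)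

lemma hvfun_zero: "hvfun 0 0 = 0"
  by (auto simp: hvfun_def fun_eq_iff intro!: sum.neutral split: sum.split)

lemma hvfun_span:
  assumes "a \<in> fs.span G" "b \<in> fs.span H"
  shows "hvfun a b \<in> fs.span ((\<lambda>a. hvfun a 0) ` G \<union> hvfun 0 ` H)"
proof -
  have "hvfun a 0 \<in> fs.span ((\<lambda>a. hvfun a 0) ` G)"
    using assms(1)
  proof (induction rule: fs.span_induct_alt)
    case (step c x y)
    have "fscale c (hvfun x 0) + hvfun y 0 \<in> fs.span ((\<lambda>a. hvfun a 0) ` G)"
      by (rule fs.span_add[OF fs.span_scale[OF fs.span_base[OF imageI]]]) (rule step)+
    moreover have "hvfun (fscale c x + y) 0 = fscale c (hvfun x 0) + hvfun y 0"
      using hvfun_add[of "fscale c x" y 0 0] hvfun_scale[of c x 0] by simp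
    ultimately show ?case by (simp only:)
  next
    case base
    show ?case unfolding hvfun_zero by (rule fs.span_zero)
  qed
  moreover have "hvfun 0 b \<in> fs.span (hvfun 0 ` H)"
    using assms(2)
  proof (induction rule: fs.span_induct_alt)
    case (step c x y)
    have "fscale c (hvfun 0 x) + hvfun 0 y \<in> fs.span (hvfun 0 ` H)"
      by (rule fs.span_add[OF fs.span_scale[OF fs.span_base[OF imageI]]]) (rule step)+
    moreover have "hvfun 0 (fscale c x + y) = fscale c (hvfun 0 x) + hvfun 0 y"
      using hvfun_add[of 0 0 "fscale c x" y] hvfun_scale[of c 0 x] by simp
    ultimately show ?case by (simp only:)
  next
    case base
    show ?case unfolding hvfun_zero by (rule fs.span_zero)
  qed
  ultimately have "hvfun a 0 + hvfun 0 b \<in> fs.span ((\<lambda>a. hvfun a 0) ` G \<union> hvfun 0 ` H)"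
    using fs.span_mono[of "(\<lambda>a. hvfun a 0) ` G" "(\<lambda>a. hvfun a 0) ` G \<union> hvfun 0 ` H"]
      fs.span_mono[of "hvfun 0 ` H" "(\<lambda>a. hvfun a 0) ` G \<union> hvfun 0 ` H"]
    by (intro fs.span_add) auto
  moreover have "hvfun a b = hvfun a 0 + hvfun 0 b" using hvfun_add[of a 0 0 b] by simp
  ultimately show ?thesis by (simp only:)
qed

lemma Acirc_sum_coadjoint:
  assumes "f \<in> Acirc_sum"
  shows "(\<lambda>v. f (hv_bracket u v)) \<in> Acirc_sum"
proof (rule coadjoint_in_subspace[OF bilinear_hv _ subspace_Acirc_sum])
  show fd: "f \<in> dual" using assms Acirc_sum_subset_dual by auto
  define a b where "a = (\<lambda>n. f (basis (Inl n)))" and "b = (\<lambda>n. f (basis (Inr n)))"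
  have rec: "recurrent a" "recurrent b"
    using assms by (simp_all add: Acirc_sum_iff a_def b_def)
  have scaled: "recurrent (\<lambda>n. (of_int n + c) * a (i + n))" "recurrent (\<lambda>n. (of_int n + c) * b (i + n))"
    for c i
    using rec by (auto simp: distrib_right
        intro!: recurrent_add recurrent_times_index recurrent_scale recurrent_shift)
  have ad_dual: "(\<lambda>v. f (hv_bracket u v)) \<in> dual" for u
    using fd by (simp add: dual_iff bilinear_linear[OF bilinear_hv])
  note coeffs = hv_bracket_simps dual_scale[OF fd] dual_minus[OF fd] dual_zero[OF fd]
  have index: "i + n - 1 = i - 1 + n" for i n :: int by simp
  show "(\<lambda>v. f (hv_bracket (basis s) v)) \<in> Acirc_sum" for s
  proof (cases s)
    case (Inl i)
    then show ?thesis
      using ad_dual scaled(1)[of "- of_int i" "i - 1"] scaled(2)[of 0 "i - 1"]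
      by (simp add: Acirc_sum_iff coeffs index a_def b_def)
  next
    case (Inr i)
    then show ?thesis
      using ad_dual recurrent_scale[OF recurrent_shift[OF rec(2), of "i - 1"], of "- of_int i"]
      by (simp add: Acirc_sum_iff coeffs index recurrent_zero b_def)
  qed
qed

text \<open>
  If \<open>f\<close> has coefficients \<open>a\<close> and \<open>b\<close>, then \<open>f \<circ> [(x\<^sup>i, 0), -]\<close> has coefficients \<open>(n - i) a (i - 1 + n)\<close>
  and \<open>n b (i - 1 + n)\<close>, and \<open>f \<circ> [(0, x\<^sup>i), -]\<close> has coefficients \<open>- i b (i - 1 + n)\<close> and \<open>0\<close>. These are
  combinations of shifts of \<open>a\<close> and \<open>b\<close> and of their products with \<open>n\<close>.
\<close>

lemma Acirc_sum_finite_coadjoint_orbit: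
  assumes "f \<in> Acirc_sum"
  shows "\<exists>Z. finite Z \<and> (\<forall>u. (\<lambda>v. f (hv_bracket u v)) \<in> fs.span Z)"
proof -
  have fd: "f \<in> dual" using assms Acirc_sum_subset_dual by auto
  define a b where "a = (\<lambda>n. f (basis (Inl n)))" and "b = (\<lambda>n. f (basis (Inr n)))"
  obtain G H where G: "finite G" "\<And>i. shift i a \<in> fs.span G"
    and H: "finite H" "\<And>i. shift i b \<in> fs.span H"
    using assms unfolding Acirc_sum_iff a_def b_def by (metis recurrentE)
  define T where "T = (\<lambda>(a :: int \<Rightarrow> 'a) j. of_int j * a j)"
  define GH where "GH = G \<union> T ` G \<union> H \<union> T ` H"
  define Z where "Z = (\<lambda>a. hvfun a 0) ` GH \<union> hvfun 0 ` GH"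
  have shifts: "shift i a \<in> fs.span GH" "shift i b \<in> fs.span GH"
    "T (shift i a) \<in> fs.span GH" "T (shift i b) \<in> fs.span GH" for i
  proof -
    have "T (shift i a) \<in> fs.span (T ` G)" "T (shift i b) \<in> fs.span (T ` H)"
      unfolding T_def by (intro span_image_times_index G H)+
    moreover have "fs.span G \<subseteq> fs.span GH" "fs.span H \<subseteq> fs.span GH"
      "fs.span (T ` G) \<subseteq> fs.span GH" "fs.span (T ` H) \<subseteq> fs.span GH"
      unfolding GH_def by (intro fs.span_mono; blast)+
    ultimately show "shift i a \<in> fs.span GH" "shift i b \<in> fs.span GH"
      "T (shift i a) \<in> fs.span GH" "T (shift i b) \<in> fs.span GH"
      using G(2)[of i] H(2)[of i] by blast+
  qed
  have ad_dual: "(\<lambda>v. f (hv_bracket u v)) \<in> dual" for u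
    using fd by (simp add: dual_iff bilinear_linear[OF bilinear_hv])
  have index: "i + n - 1 = i - 1 + n" for i n :: int by simp
  have basis_case: "(\<lambda>v. f (hv_bracket (basis s) v)) \<in> fs.span Z" for s
  proof (cases s)
    case (Inl i)
    have "(\<lambda>v. f (hv_bracket (basis s) v)) =
        hvfun (T (shift (i - 1) a) - fscale (of_int i) (shift (i - 1) a)) (T (shift (i - 1) b))"
      by (subst hvfun_coefficients[OF ad_dual], intro arg_cong2[where f = hvfun] ext)
         (simp_all add: Inl hv_bracket_simps dual_scale[OF fd] T_def fscale_def shift_def index
           a_def b_def left_diff_distrib)
    also have "\<dots> \<in> fs.span Z"
      unfolding Z_def by (intro hvfun_span fs.span_diff fs.span_scale shifts)
    finally show ?thesis .
  next
    case (Inr i)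
    have "(\<lambda>v. f (hv_bracket (basis s) v)) = hvfun (fscale (- of_int i) (shift (i - 1) b)) 0"
      by (subst hvfun_coefficients[OF ad_dual], intro arg_cong2[where f = hvfun] ext)
         (simp_all add: Inr hv_bracket_simps dual_scale[OF fd] dual_minus[OF fd] dual_zero[OF fd]
           fscale_def shift_def index b_def)
    also have "\<dots> \<in> fs.span Z"
      unfolding Z_def by (intro hvfun_span fs.span_scale fs.span_zero shifts)
    finally show ?thesis .
  qed
  have "(\<lambda>v. f (hv_bracket u v)) \<in> fs.span Z" for u
    by (rule coadjoint_in_subspace[OF bilinear_hv fd fs.subspace_span basis_case])
  moreover have "finite Z" using G(1) H(1) by (simp add: Z_def GH_def)
  ultimately show ?thesis by blast
qed

lemma good_subspace_Acirc_sum: "good_subspace hv_bracket Acirc_sum"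
  by (intro good_subspaceI lie_algebra_hv subspace_Acirc_sum Acirc_sum_subset_dual
      Acirc_sum_coadjoint Acirc_sum_finite_coadjoint_orbit)

lemma max_good_hv: "max_good hv_bracket = (Acirc_sum :: ('k::field_char_0 hv \<Rightarrow> 'k) set)"
proof
  show "max_good hv_bracket \<subseteq> (Acirc_sum :: ('k hv \<Rightarrow> 'k) set)"
    unfolding max_good_def
    by (intro fs.span_minimal subspace_Acirc_sum Union_least) (auto dest: good_subspace_hv_le)
  show "(Acirc_sum :: ('k hv \<Rightarrow> 'k) set) \<subseteq> max_good hv_bracket"
    unfolding max_good_def using good_subspace_Acirc_sum by (blast intro: fs.span_base)
qed

section \<open>Formal sums\<close>

lemma formal_sum_unique: "formal_sum g I F \<Longrightarrow> formal_sum g I F' \<Longrightarrow> F = F'"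
  by (auto simp: formal_sum_def fun_eq_iff)

text \<open>For functionals it suffices to evaluate on a basis vector, where at most one term survives.\<close>

lemma formal_sum_dualI:
  fixes F :: "('b, 'k::field) functional"
  assumes g: "\<And>i. i \<in> I \<Longrightarrow> g i \<in> dual" and F: "F \<in> dual"
    and single: "\<And>b. \<exists>i0. (\<forall>i\<in>I. i \<noteq> i0 \<longrightarrow> g i (basis b) = 0) \<and>
                   F (basis b) = (if i0 \<in> I then g i0 (basis b) else 0)"
  shows "formal_sum g I F"
  unfolding formal_sum_def
proof
  fix x :: "'b \<Rightarrow>\<^sub>0 'k"
  obtain i0 where i0: "\<And>b i. i \<in> I \<Longrightarrow> i \<noteq> i0 b \<Longrightarrow> g i (basis b) = 0"
    "\<And>b. F (basis b) = (if i0 b \<in> I then g (i0 b) (basis b) else 0)"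
    using single by metis
  define J where "J = I \<inter> i0 ` Poly_Mapping.keys x"
  have J: "finite J" "J \<subseteq> I" by (auto simp: J_def)
  have zero: "g i x = 0" if "i \<in> I" "i \<notin> J" for i
    unfolding dual_expand[OF g[OF that(1)], of x]
    by (rule sum.neutral) (use that i0(1) in \<open>auto simp: J_def\<close>)
  have sub: "{i \<in> I. g i x \<noteq> 0} \<subseteq> J" using zero by auto
  have "F x = (\<Sum>b\<in>Poly_Mapping.keys x. Poly_Mapping.lookup x b * F (basis b))"
    by (rule dual_expand[OF F])
  also have "\<dots> = (\<Sum>b\<in>Poly_Mapping.keys x. \<Sum>i\<in>J. Poly_Mapping.lookup x b * g i (basis b))"
  proof (rule sum.cong)
    fix b assume b: "b \<in> Poly_Mapping.keys x"
    have "(\<Sum>i\<in>J. Poly_Mapping.lookup x b * g i (basis b)) =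
        (\<Sum>i\<in>J. if i = i0 b then Poly_Mapping.lookup x b * g i (basis b) else 0)"
      by (rule sum.cong) (use i0(1) J in auto)
    also have "\<dots> = Poly_Mapping.lookup x b * F (basis b)"
      using J(1) b by (auto simp: i0(2) J_def)
    finally show "Poly_Mapping.lookup x b * F (basis b) =
        (\<Sum>i\<in>J. Poly_Mapping.lookup x b * g i (basis b))" by simp
  qed simp
  also have "\<dots> = (\<Sum>i\<in>J. g i x)"
    by (subst sum.swap, rule sum.cong) (use J in \<open>auto simp: dual_expand[OF g, of _ x]\<close>)
  also have "\<dots> = (\<Sum>i | i \<in> I \<and> g i x \<noteq> 0. g i x)"
    by (rule sum.mono_neutral_right) (use J sub in auto)
  finally show "finite {i \<in> I. g i x \<noteq> 0} \<and> F x = (\<Sum>i | i \<in> I \<and> g i x \<noteq> 0. g i x)"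
    using sub J(1) by (auto intro: finite_subset)
qed

text \<open>
  The expansion of \<open>f\<close> in the dual basis, pulled back along an arbitrary map \<open>h\<close>.
\<close>

lemma formal_sum_expansion:
  fixes h :: "'x \<Rightarrow> 'b \<Rightarrow>\<^sub>0 'k::field"
  assumes "f \<in> dual"
  shows "formal_sum (\<lambda>b x. f (basis b) * Poly_Mapping.lookup (h x) b) UNIV (\<lambda>x. f (h x))"
  unfolding formal_sum_def
proof
  fix x
  have sub: "{b \<in> UNIV. f (basis b) * Poly_Mapping.lookup (h x) b \<noteq> 0} \<subseteq> Poly_Mapping.keys (h x)"
    by (auto simp: in_keys_iff)
  have "f (h x) = (\<Sum>b\<in>Poly_Mapping.keys (h x). f (basis b) * Poly_Mapping.lookup (h x) b)"
    by (subst dual_expand[OF assms]) (simp add: mult.commute)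
  also have "\<dots> = (\<Sum>b | b \<in> UNIV \<and> f (basis b) * Poly_Mapping.lookup (h x) b \<noteq> 0.
      f (basis b) * Poly_Mapping.lookup (h x) b)"
    by (rule sum.mono_neutral_right) (use sub in auto)
  finally show "finite {b \<in> UNIV. f (basis b) * Poly_Mapping.lookup (h x) b \<noteq> 0} \<and>
      f (h x) = (\<Sum>b | b \<in> UNIV \<and> f (basis b) * Poly_Mapping.lookup (h x) b \<noteq> 0.
        f (basis b) * Poly_Mapping.lookup (h x) b)"
    using sub by (auto intro: finite_subset)
qed

lemma formally_linear_dual_map:
  fixes \<phi> :: "('b, 'k::field) bracket"
  shows "formally_linear (dual_map \<phi>)"
  unfolding formally_linear_def
proof
  fix f :: "('b, 'k) functional" assume "f \<in> dual"
  from formal_sum_expansion[OF this, of "tlift vscale \<phi>"]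
  show "formal_sum (\<lambda>b. fscale (f (basis b)) (dual_map \<phi> (dual_basis b))) UNIV (dual_map \<phi> f)"
    by (simp add: dual_map_def fscale_def dual_basis_def o_def)
qed

lemma formally_bilinear_dual_bracket:
  fixes \<delta> :: "('b, 'k::field) cobracket"
  shows "formally_bilinear (dual_bracket \<delta>)"
  unfolding formally_bilinear_def
proof (intro ballI)
  fix f h :: "('b, 'k) functional" assume fh: "f \<in> dual" "h \<in> dual"
  have db: "dual_basis b \<otimes>\<^sub>f dual_basis c = (dual_basis (b, c) :: ('b \<times> 'b, 'k) functional)" for b c
    by (rule dual_eqI)
       (auto simp: ftensor_in_dual dual_basis_in_dual ftensor_basis dual_basis_basis split_paired_all)
  have eq: "(\<lambda>(b, c). fscale (f (basis b) * h (basis c)) (dual_bracket \<delta> (dual_basis b) (dual_basis c))) =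
      (\<lambda>p x. (f \<otimes>\<^sub>f h) (basis p) * Poly_Mapping.lookup (\<delta> x) p)"
    by (auto simp: fun_eq_iff fscale_def dual_bracket_def db dual_basis_def ftensor_basis)
  show "formal_sum (\<lambda>(b, c). fscale (f (basis b) * h (basis c))
      (dual_bracket \<delta> (dual_basis b) (dual_basis c))) UNIV (dual_bracket \<delta> f h)"
    unfolding eq using formal_sum_expansion[OF ftensor_in_dual, of f h \<delta>]
    by (simp add: dual_bracket_def o_def)
qed

lemma formally_linear_unique:
  assumes "formally_linear F" "formally_linear F'" "\<And>b. F (dual_basis b) = F' (dual_basis b)"
    and "f \<in> dual"
  shows "F f = F' f"
proof (rule formal_sum_unique)
  show "formal_sum (\<lambda>b. fscale (f (basis b)) (F' (dual_basis b))) UNIV (F f)"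
    "formal_sum (\<lambda>b. fscale (f (basis b)) (F' (dual_basis b))) UNIV (F' f)"
    using assms by (simp_all add: formally_linear_def)
qed

lemma formally_bilinear_unique:
  assumes "formally_bilinear B" "formally_bilinear B'"
    and "\<And>b c. B (dual_basis b) (dual_basis c) = B' (dual_basis b) (dual_basis c)"
    and "f \<in> dual" "h \<in> dual"
  shows "B f h = B' f h"
proof (rule formal_sum_unique)
  let ?g = "\<lambda>(b, c). fscale (f (basis b) * h (basis c)) (B' (dual_basis b) (dual_basis c))"
  show "formal_sum ?g UNIV (B f h)" "formal_sum ?g UNIV (B' f h)"
    using assms(1,2,4,5) unfolding formally_bilinear_def assms(3) by blast+
qed

section \<open>Explicit formulas for the dual operations\<close>

lemma eps1_in_dual: "eps1 i \<in> dual" and eps2_in_dual: "eps2 i \<in> dual"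
  by (simp_all add: eps1_eq eps2_eq dual_basis_in_dual)

lemma eps_basis:
  "eps1 i (basis (Inl k)) = (if i = k then 1 else 0)" "eps1 i (basis (Inr k)) = 0"
  "eps2 i (basis (Inl k)) = 0" "eps2 i (basis (Inr k)) = (if i = k then 1 else 0)"
  by (simp_all add: eps1_eq eps2_eq dual_basis_basis)

lemma fscale_apply: "fscale c f x = c * f x"
  by (simp add: fscale_def)

lemma cobracket_formulas_dual_map: "cobracket_formulas (dual_map hv_bracket)"
  unfolding cobracket_formulas_def
proof (intro conjI allI formally_linear_dual_map)
  note eval = eps_basis dual_scale[OF eps1_in_dual] dual_scale[OF eps2_in_dual]
    dual_minus[OF eps1_in_dual] dual_minus[OF eps2_in_dual]
    dual_zero[OF eps1_in_dual] dual_zero[OF eps2_in_dual] hv_bracket_simps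
    dual_map_tensor[OF bilinear_hv] ftensor_basis fscale_apply basis_tensor_basis[symmetric]
    ftensor_tensor[OF eps1_in_dual eps1_in_dual] ftensor_tensor[OF eps1_in_dual eps2_in_dual]
    ftensor_tensor[OF eps2_in_dual eps1_in_dual]
  fix p :: int
  show "formal_sum (\<lambda>(i, j). fscale (of_int (j - i)) (eps1 i \<otimes>\<^sub>f eps1 j)) {(i, j). i + j = p + 1}
      (dual_map hv_bracket (eps1 p :: 'a hv \<Rightarrow> 'a))"
  proof (rule formal_sum_dualI)
    fix b :: "(int + int) \<times> (int + int)"
    obtain s t where b: "b = (s, t)" by (cases b)
    define i0 where "i0 = (case_sum id id s, case_sum id id t)"
    show "\<exists>i0. (\<forall>i\<in>{(i, j). i + j = p + 1}. i \<noteq> i0 \<longrightarrow>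
          (case i of (i, j) \<Rightarrow> fscale (of_int (j - i)) (eps1 i \<otimes>\<^sub>f eps1 j)) (basis b) = 0) \<and>
        dual_map hv_bracket (eps1 p) (basis b) = (if i0 \<in> {(i, j). i + j = p + 1}
          then (case i0 of (i, j) \<Rightarrow> fscale (of_int (j - i)) (eps1 i \<otimes>\<^sub>f eps1 j)) (basis b) else 0 :: 'a)"
      by (rule exI[of _ i0]) (cases s; cases t; auto simp: b i0_def eval)
  qed (auto intro!: fun_scale_in_dual ftensor_in_dual dual_map_in_dual eps1_in_dual)
  show "formal_sum (\<lambda>(i, j). fscale (of_int j) (eps1 i \<otimes>\<^sub>f eps2 j) - fscale (of_int i) (eps2 i \<otimes>\<^sub>f eps1 j))
      {(i, j). i + j = p + 1} (dual_map hv_bracket (eps2 p :: 'a hv \<Rightarrow> 'a))"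
  proof (rule formal_sum_dualI)
    fix b :: "(int + int) \<times> (int + int)"
    obtain s t where b: "b = (s, t)" by (cases b)
    define i0 where "i0 = (case_sum id id s, case_sum id id t)"
    show "\<exists>i0. (\<forall>i\<in>{(i, j). i + j = p + 1}. i \<noteq> i0 \<longrightarrow>
          (case i of (i, j) \<Rightarrow> fscale (of_int j) (eps1 i \<otimes>\<^sub>f eps2 j) -
             fscale (of_int i) (eps2 i \<otimes>\<^sub>f eps1 j)) (basis b) = 0) \<and>
        dual_map hv_bracket (eps2 p) (basis b) = (if i0 \<in> {(i, j). i + j = p + 1}
          then (case i0 of (i, j) \<Rightarrow> fscale (of_int j) (eps1 i \<otimes>\<^sub>f eps2 j) -
             fscale (of_int i) (eps2 i \<otimes>\<^sub>f eps1 j)) (basis b) else 0 :: 'a)"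
      by (rule exI[of _ i0]) (cases s; cases t; auto simp: b i0_def eval)
  qed (auto intro!: fun_diff_in_dual fun_scale_in_dual ftensor_in_dual dual_map_in_dual eps2_in_dual)
qed

lemma cobracket_formulas_unique:
  assumes "cobracket_formulas \<Delta>" "cobracket_formulas \<Delta>'" "f \<in> dual"
  shows "\<Delta>' f = \<Delta> f"
proof (rule formally_linear_unique[OF _ _ _ assms(3)])
  have "\<Delta>' (eps1 p) = \<Delta> (eps1 p)" "\<Delta>' (eps2 p) = \<Delta> (eps2 p)" for p
    using assms(1,2) unfolding cobracket_formulas_def by (blast intro: formal_sum_unique)+
  then show "\<Delta>' (dual_basis b) = \<Delta> (dual_basis b)" for b
    by (cases b) (simp_all flip: eps1_eq eps2_eq)
qed (use assms in \<open>auto simp: cobracket_formulas_def\<close>)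

text \<open>
  The brackets of \<open>(0, \<epsilon>\<^sup>i)\<close> with \<open>(0, \<epsilon>\<^sup>m)\<close> are not among the conclusions; they follow from
  skew-symmetry, and for \<open>i = m\<close> from characteristic different from 2.
\<close>

lemma bracket_formulasD:
  assumes "bracket_formulas m q br"
  shows "formally_bilinear br"
    and "f \<in> dual \<Longrightarrow> h \<in> dual \<Longrightarrow> br f h = - br h f"
    and "br (eps1 i) (eps1 j) = 0"
    and "br (eps1 i) (eps2 j) =
        (if i = 1 then fscale (of_int m * q) (eps1 (j - m + 1))
         else if j = m then fscale (of_int (1 - i) * q) (eps1 i) else 0)"
    and "j \<noteq> m \<Longrightarrow> br (eps2 i) (eps2 j) = (if i = m then fscale (of_int j * q) (eps2 j) else 0)"
proof -
  note D = assms[unfolded bracket_formulas_def]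
  show "formally_bilinear br" by (rule D[THEN conjunct1])
  show "br f h = - br h f" if "f \<in> dual" "h \<in> dual"
    by (rule D[THEN conjunct2, THEN conjunct1, rule_format, OF that])
  show "br (eps1 i) (eps1 j) = 0"
    by (rule D[THEN conjunct2, THEN conjunct2, THEN conjunct1, rule_format])
  show "br (eps1 i) (eps2 j) =
        (if i = 1 then fscale (of_int m * q) (eps1 (j - m + 1))
         else if j = m then fscale (of_int (1 - i) * q) (eps1 i) else 0)"
    by (rule D[THEN conjunct2, THEN conjunct2, THEN conjunct2, THEN conjunct1, rule_format])
  show "br (eps2 i) (eps2 j) = (if i = m then fscale (of_int j * q) (eps2 j) else 0)" if "j \<noteq> m"
    using D[THEN conjunct2, THEN conjunct2, THEN conjunct2, THEN conjunct2] that by simp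
qed

lemma bracket_formulas_unique:
  fixes q :: "'k::field_char_0"
  assumes "bracket_formulas m q br" "bracket_formulas m q br'" "f \<in> dual" "h \<in> dual"
  shows "br' f h = br f h"
proof (rule formally_bilinear_unique[OF _ _ _ assms(3,4)])
  have skew: "B (eps2 i) (eps1 j) = - B (eps1 j) (eps2 i)" "B (eps2 i) (eps2 j) = - B (eps2 j) (eps2 i)"
    if "bracket_formulas m q B" for B :: "('k hv \<Rightarrow> 'k) \<Rightarrow> ('k hv \<Rightarrow> 'k) \<Rightarrow> 'k hv \<Rightarrow> 'k" and i j
    by (intro bracket_formulasD(2)[OF that] eps1_in_dual eps2_in_dual)+
  have self: "B (eps2 i) (eps2 i) = 0"
    if "bracket_formulas m q B" for B :: "('k hv \<Rightarrow> 'k) \<Rightarrow> ('k hv \<Rightarrow> 'k) \<Rightarrow> 'k hv \<Rightarrow> 'k" and i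
  proof
    fix x
    have "B (eps2 i) (eps2 i) x = - B (eps2 i) (eps2 i) x"
      using fun_cong[OF skew(2)[OF that, of i i], of x] by simp
    then show "B (eps2 i) (eps2 i) x = 0 x" by (simp add: eq_neg_iff_add_eq_0 flip: mult_2)
  qed
  have 11: "br' (eps1 i) (eps1 j) = br (eps1 i) (eps1 j)" for i j
    by (simp only: assms(1,2)[THEN bracket_formulasD(3)])
  have 12: "br' (eps1 i) (eps2 j) = br (eps1 i) (eps2 j)" for i j
    by (simp only: assms(1,2)[THEN bracket_formulasD(4)])
  have 22: "br' (eps2 i) (eps2 j) = br (eps2 i) (eps2 j)" if "j \<noteq> m" for i j
    by (simp only: assms(1,2)[THEN bracket_formulasD(5), OF that])
  have eps22: "br' (eps2 i) (eps2 j) = br (eps2 i) (eps2 j)" for i j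
  proof (cases "j = m \<and> i = m")
    case True
    then show ?thesis using self[OF assms(1)] self[OF assms(2)] by simp
  next
    case False
    then show ?thesis
      using 22 skew(2)[OF assms(1), of i j] skew(2)[OF assms(2), of i j] by metis
  qed
  show "br' (dual_basis b) (dual_basis c) = br (dual_basis b) (dual_basis c)" for b c
    by (cases b; cases c)
       (simp_all add: 11 12 eps22 skew(1)[OF assms(1)] skew(1)[OF assms(2)] flip: eps1_eq eps2_eq)
qed (rule assms(1,2)[THEN bracket_formulasD(1)])+

lemma dual_bracket_wedge:
  assumes "\<phi> \<in> bilinear_maps vscale" "f \<in> dual" "h \<in> dual"
  shows "dual_bracket (coboundary \<phi> (a \<otimes>\<^sub>t b - b \<otimes>\<^sub>t a)) f h z =
    f (\<phi> z a) * h b + f a * h (\<phi> z b) - f (\<phi> z b) * h a - f b * h (\<phi> z a)"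
  by (simp add: dual_bracket_def coboundary_wedge[OF assms(1)] dual_add[OF ftensor_in_dual]
      dual_diff[OF ftensor_in_dual] ftensor_tensor assms(2,3))

text \<open>
  In \<open>dual_bracket_wedge\<close>, every term is a multiple of a coadjoint translate of \<open>f\<close> or of \<open>h\<close>.
\<close>

lemma dual_bracket_wedge_closed:
  assumes lie: "lie_algebra \<phi>" and sub: "fs.subspace C" and C: "C \<subseteq> dual"
    and coad: "\<And>f u. f \<in> C \<Longrightarrow> (\<lambda>v. f (\<phi> u v)) \<in> C"
    and f: "f \<in> C" and h: "h \<in> C"
  shows "dual_bracket (coboundary \<phi> (a \<otimes>\<^sub>t b - b \<otimes>\<^sub>t a)) f h \<in> C"
proof -
  have fh: "f \<in> dual" "h \<in> dual" using f h C by auto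
  have flip: "k (\<phi> z u) = - k (\<phi> u z)" if "k \<in> dual" for k z u
    using dual_minus[OF that] lie_algebra_skew[OF lie] by metis
  have "dual_bracket (coboundary \<phi> (a \<otimes>\<^sub>t b - b \<otimes>\<^sub>t a)) f h =
      fscale (- h b) (\<lambda>v. f (\<phi> a v)) + fscale (- f a) (\<lambda>v. h (\<phi> b v)) +
      fscale (h a) (\<lambda>v. f (\<phi> b v)) + fscale (f b) (\<lambda>v. h (\<phi> a v))"
    using flip[OF fh(1), of _ a] flip[OF fh(1), of _ b] flip[OF fh(2), of _ a] flip[OF fh(2), of _ b]
    by (auto simp: fun_eq_iff dual_bracket_wedge[OF lie_algebra_bilinear[OF lie] fh] fscale_def)
  also have "\<dots> \<in> C"
    by (intro fs.subspace_add[OF sub] fs.subspace_scale[OF sub] coad f h)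
  finally show ?thesis .
qed

lemma hv_wedge_dual:
  fixes m :: int and q :: "'k::field_char_0"
  defines "t \<equiv> basis (Inl 1) \<otimes>\<^sub>t vscale q (basis (Inr m)) - vscale q (basis (Inr m)) \<otimes>\<^sub>t basis (Inl 1)"
  shows "coboundary_triangular hv_bracket (coboundary hv_bracket t) t"
    and "bracket_formulas m q (dual_bracket (coboundary hv_bracket t))"
    and "dual_lie_bialgebra hv_bracket (coboundary hv_bracket t) Acirc_sum
           (dual_bracket (coboundary hv_bracket t)) (dual_map hv_bracket)"
proof -
  define a b :: "'k hv" where "a = basis (Inl 1)" and "b = vscale q (basis (Inr m))"
  have t: "t = a \<otimes>\<^sub>t b - b \<otimes>\<^sub>t a" by (simp add: t_def a_def b_def)
  have ab: "hv_bracket a b = vscale (of_int m) b"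
    by (simp add: a_def b_def bilinear_linear[OF bilinear_hv] hv_bracket_simps mult.commute)
  show tri: "coboundary_triangular hv_bracket (coboundary hv_bracket t) t"
    unfolding t by (rule coboundary_triangular_wedge[OF lie_algebra_hv ab])
  then have bialg: "lie_bialgebra hv_bracket (coboundary hv_bracket t)"
    by (simp add: coboundary_triangular_def)
  then have co: "lie_coalgebra (coboundary hv_bracket t)" by (simp add: lie_bialgebra_def)
  have closed: "dual_bracket (coboundary hv_bracket t) f h \<in> Acirc_sum"
    if "f \<in> Acirc_sum" "h \<in> Acirc_sum" for f h
    unfolding t
    by (rule dual_bracket_wedge_closed[OF lie_algebra_hv subspace_Acirc_sum Acirc_sum_subset_dual
          Acirc_sum_coadjoint that])
  show "dual_lie_bialgebra hv_bracket (coboundary hv_bracket t) Acirc_sum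
           (dual_bracket (coboundary hv_bracket t)) (dual_map hv_bracket)"
    unfolding dual_lie_bialgebra_def
    using lie_bialgebra_on_good_subspace[OF bialg good_subspace_Acirc_sum closed]
    by (auto simp: max_good_hv dual_bracket_def dual_map_tensor[OF bilinear_hv])
  show "bracket_formulas m q (dual_bracket (coboundary hv_bracket t))"
    unfolding bracket_formulas_def
  proof (intro conjI allI ballI impI formally_bilinear_dual_bracket)
    note eval = dual_bracket_wedge[OF bilinear_hv, of _ _ a b, folded t] eps1_in_dual eps2_in_dual
      a_def b_def bilinear_linear[OF bilinear_hv] hv_bracket_simps eps_basis
      dual_scale[OF eps1_in_dual] dual_scale[OF eps2_in_dual]
      dual_minus[OF eps1_in_dual] dual_minus[OF eps2_in_dual]
      dual_zero[OF eps1_in_dual] dual_zero[OF eps2_in_dual] fscale_apply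
    have eqI: "dual_bracket (coboundary hv_bracket t) f h = k"
      if "k \<in> dual"
        "\<And>n. dual_bracket (coboundary hv_bracket t) f h (basis (Inl n)) = k (basis (Inl n))"
        "\<And>n. dual_bracket (coboundary hv_bracket t) f h (basis (Inr n)) = k (basis (Inr n))"
      for f h k
    proof (rule dual_eqI[OF dual_bracket_in_dual[OF lie_coalgebra_linear[OF co]] that(1)])
      show "dual_bracket (coboundary hv_bracket t) f h (basis s) = k (basis s)" for s
        using that by (cases s) auto
    qed
    fix i j :: int
    show "dual_bracket (coboundary hv_bracket t) f h = - dual_bracket (coboundary hv_bracket t) h f"
      if "f \<in> dual" "h \<in> dual" for f h
      by (rule dual_bracket_skew[OF co that])
    show "dual_bracket (coboundary hv_bracket t) (eps1 i) (eps1 j) = 0"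
      by (rule eqI) (simp_all add: zero_in_dual eval)
    show "dual_bracket (coboundary hv_bracket t) (eps1 i) (eps2 j) =
        (if i = 1 then fscale (of_int m * q) (eps1 (j - m + 1))
         else if j = m then fscale (of_int (1 - i) * q) (eps1 i) else 0)"
      by (rule eqI) (auto simp: zero_in_dual fun_scale_in_dual eval)
    show "dual_bracket (coboundary hv_bracket t) (eps2 i) (eps2 j) = fscale (of_int j * q) (eps2 j)"
      if "i = m \<and> j \<noteq> m"
      by (rule eqI) (use that in \<open>auto simp: fun_scale_in_dual eval\<close>)
    show "dual_bracket (coboundary hv_bracket t) (eps2 i) (eps2 j) = 0" if "i \<noteq> m \<and> j \<noteq> m"
      by (rule eqI) (use that in \<open>auto simp: zero_in_dual eval\<close>)
  qed
qed

theorem theorem3p8: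
  fixes m :: int and q :: "'k::{alg_closed_field, field_char_0}"
  defines "r \<equiv> hv (X 1) 0 \<otimes>\<^sub>t hv (X 1) (vscale q (X m)) - hv (X 1) (vscale q (X m)) \<otimes>\<^sub>t hv (X 1) 0"
    and "r' \<equiv> hv (X 1) 0 \<otimes>\<^sub>t hv 0 (vscale q (X m)) - hv 0 (vscale q (X m)) \<otimes>\<^sub>t hv (X 1) 0"
  shows "\<exists>\<Delta>. cobracket_formulas \<Delta> \<and>
     (\<forall>\<Delta>'. cobracket_formulas \<Delta>' \<longrightarrow> (\<forall>f\<in>dual. \<Delta>' f = \<Delta> f)) \<and>
     (\<forall>f\<in>dual. \<Delta> f = dual_map hv_bracket f) \<and>
     (coboundary_triangular hv_bracket (coboundary hv_bracket r) r \<and>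
      (\<exists>br. bracket_formulas m q br \<and>
         (\<forall>br'. bracket_formulas m q br' \<longrightarrow> (\<forall>f\<in>dual. \<forall>h\<in>dual. br' f h = br f h)) \<and>
         (\<forall>f\<in>dual. \<forall>h\<in>dual. br f h = dual_bracket (coboundary hv_bracket r) f h) \<and>
         dual_lie_bialgebra hv_bracket (coboundary hv_bracket r) Acirc_sum br \<Delta>)) \<and>
     (coboundary_triangular hv_bracket (coboundary hv_bracket r') r' \<and>
      (\<exists>br. bracket_formulas m q br \<and>
         (\<forall>br'. bracket_formulas m q br' \<longrightarrow> (\<forall>f\<in>dual. \<forall>h\<in>dual. br' f h = br f h)) \<and>
         (\<forall>f\<in>dual. \<forall>h\<in>dual. br f h = dual_bracket (coboundary hv_bracket r') f h) \<and>
         dual_lie_bialgebra hv_bracket (coboundary hv_bracket r') Acirc_sum br \<Delta>))"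
proof -
  define t :: "(int + int) \<times> (int + int) \<Rightarrow>\<^sub>0 'k" where
    "t = basis (Inl 1) \<otimes>\<^sub>t vscale q (basis (Inr m)) - vscale q (basis (Inr m)) \<otimes>\<^sub>t basis (Inl 1)"
  have b: "hv 0 (vscale q (X m)) = vscale q (basis (Inr m))"
    by (simp add: vscale_hv flip: hv_zero_X)
  have ab: "hv (X 1) (vscale q (X m)) = basis (Inl 1) + vscale q (basis (Inr m))"
    by (simp add: hv_add flip: hv_X_zero b)
  have r': "r' = t" by (simp add: r'_def t_def b hv_X_zero)
  \<comment> \<open>The extra summand of \<open>r\<close> is \<open>(x, 0) \<otimes> (x, 0) - (x, 0) \<otimes> (x, 0)\<close>, so \<open>r = r'\<close>.\<close>
  have r: "r = t" by (simp add: r_def t_def ab hv_X_zero tensor_linear)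
  note t_dual = hv_wedge_dual[where q = q and m = m, folded t_def]
  have "\<exists>br. bracket_formulas m q br \<and>
         (\<forall>br'. bracket_formulas m q br' \<longrightarrow> (\<forall>f\<in>dual. \<forall>h\<in>dual. br' f h = br f h)) \<and>
         (\<forall>f\<in>dual. \<forall>h\<in>dual. br f h = dual_bracket (coboundary hv_bracket t) f h) \<and>
         dual_lie_bialgebra hv_bracket (coboundary hv_bracket t) Acirc_sum br (dual_map hv_bracket)"
    by (rule exI[of _ "dual_bracket (coboundary hv_bracket t)"])
       (use t_dual bracket_formulas_unique[OF t_dual(2)] in blast)
  then show ?thesis
    unfolding r r'
    by (intro exI[of _ "dual_map hv_bracket"])
       (use t_dual(1) cobracket_formulas_dual_map
          cobracket_formulas_unique[OF cobracket_formulas_dual_map] in blast)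
qed

end
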